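(* Let $G$ be a countable directed graph with no sinks. Let $T=(T_e)_{e\in E(G)}$ be a row contraction on a Hilbert space $\mathcal{H}$ which is stabilized by a family of projections $\{P_x : x\in V(G)\}$ on $\mathcal{H}$ (with associated directed graph $G$). Then $$\|p(T)\|\le\|p\|_\infty\qquad\text{for all } p\in\mathcal{P}_G^+ .$$
   Context: $G$ is a countable directed graph with edge set $E(G)$ and vertex set $V(G)$; $s(e)$, $r(e)$ denote the source and range vertices of an edge $e$. $G$ has no sinks if every vertex is the source of some edge. The free semigroupoid $\mathbb{F}^+(G)$ is the set of all vertices and all finite paths $w=e_k\cdots e_1$ of $G$ (with $s(e_{i+1})=r(e_i)$, $s(w)=s(e_1)$, $r(w)=r(e_k)$, and $s(x)=r(x)=x$ for vertices), with concatenation. The path algebra $\mathcal{P}_G^+$ is the set of finite complex linear combinations of elements of $\mathbb{F}^+(G)$. Row contraction: $T=(T_e)_{e\in E(G)}$ is a family of non-zero bounded operators on $\mathcal{H}$ with $\sum_{e}T_eT_e^*\le I$. Stabilization: $\{P_x:x\in V(G)\}$ is a family of mutually orthogonal projections on $\mathcal{H}$ which sum to the identity and satisfy $T_eP_x,\ P_xT_e\in\{T_e,0\}$ for all $e\in E(G)$, $x\in V(G)$; the associated graph is $G$, meaning $P_{r(e)}T_eP_{s(e)}=T_e$ for all $e\in E(G)$. For $p\in\mathcal{P}_G^+$, $p(T)$ is obtained by replacing each edge $e$ by $T_e$ and each vertex $x$ by $P_x$ (a path $e_k\cdots e_1$ becomes $T_{e_k}\cdots T_{e_1}$). Norm: $\mathcal{H}_G$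 is the Hilbert space with orthonormal basis $\{\xi_w : w\in\mathbb{F}^+(G)\}$; $L_e\xi_w=\xi_{ew}$ if $r(w)=s(e)$ and $0$ otherwise; the vertex $x$ is represented on $\mathcal{H}_G$ by the projection onto $\overline{\mathrm{span}}\{\xi_w:r(w)=x\}$. With $L_G=(L_e)_{e\in E(G)}$, $\|p\|_\infty:=\|p(L_G)\|$. *)

theory Defs
  imports
    "HOL-Analysis.Analysis"
    "HOL-Library.Poly_Mapping"
    "Graph_Theory.Digraph"
begin

section \<open>Complex Hilbert spaces\<close>

text \<open>The inner product is linear in its first argument. Norm, topology and completeness are the
  ones of the underlying real normed space.\<close>

class complex_inner = real_normed_vector +
  fixes scaleC :: "complex \<Rightarrow> 'a \<Rightarrow> 'a" (infixr \<open>*\<^sub>C\<close> 75)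
    and cinner :: "'a \<Rightarrow> 'a \<Rightarrow> complex"
  assumes scaleC_add_right: "c *\<^sub>C (x + y) = c *\<^sub>C x + c *\<^sub>C y"
    and scaleC_add_left: "(c + d) *\<^sub>C x = c *\<^sub>C x + d *\<^sub>C x"
    and scaleC_scaleC: "c *\<^sub>C (d *\<^sub>C x) = (c * d) *\<^sub>C x"
    and scaleC_of_real: "complex_of_real r *\<^sub>C x = r *\<^sub>R x"
    and cinner_commute: "cinner x y = cnj (cinner y x)"
    and cinner_add_left: "cinner (x + y) z = cinner x z + cinner y z"
    and cinner_scaleC_left: "cinner (c *\<^sub>C x) y = c * cinner x y"
    and cinner_self: "cinner x x = complex_of_real ((norm x)\<^sup>2)"

class chilbert_space = complex_inner + banach

definition bounded_clinear :: "('a::complex_inner \<Rightarrow> 'b::complex_inner) \<Rightarrow> bool" where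
  "bounded_clinear A \<longleftrightarrow> bounded_linear A \<and> (\<forall>c x. A (c *\<^sub>C x) = c *\<^sub>C A x)"

definition cadjoint :: "('a::complex_inner \<Rightarrow> 'b::complex_inner) \<Rightarrow> 'b \<Rightarrow> 'a" where
  "cadjoint A = (THE B. \<forall>x y. cinner (A x) y = cinner x (B y))"

definition is_orthogonal_projection :: "('a::complex_inner \<Rightarrow> 'a) \<Rightarrow> bool" where
  "is_orthogonal_projection P \<longleftrightarrow> bounded_clinear P \<and> P \<circ> P = P \<and> cadjoint P = P"

text \<open>The usual order on operators: the difference is a positive operator.\<close>

definition operator_le :: "('a::complex_inner \<Rightarrow> 'a) \<Rightarrow> ('a \<Rightarrow> 'a) \<Rightarrow> bool" where
  "operator_le A B \<longleftrightarrow> (\<forall>x. cinner (B x - A x) x \<in> \<real>\<^sub>\<ge>\<^sub>0)"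

subsection \<open>Existence and uniqueness of adjoints\<close>

lemma cinner_add_right: "cinner x (y + z) = cinner x y + cinner x z"
  by (metis cinner_add_left cinner_commute complex_cnj_add)

lemma cinner_scaleC_right: "cinner x (c *\<^sub>C y) = cnj c * cinner x y"
  by (metis cinner_commute cinner_scaleC_left complex_cnj_mult)

lemma cinner_scaleR_left: "cinner (r *\<^sub>R x) y = of_real r * cinner x y"
  by (metis cinner_scaleC_left scaleC_of_real)

lemma cinner_scaleR_right: "cinner x (r *\<^sub>R y) = of_real r * cinner x y"
  by (metis cinner_scaleC_right scaleC_of_real complex_cnj_complex_of_real)

lemma cinner_minus_left: "cinner (- x) y = - cinner x y"
  using cinner_scaleR_left[of "-1" x y] by simp

lemma cinner_minus_right: "cinner x (- y) = - cinner x y"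
  using cinner_scaleR_right[of x "-1" y] by simp

lemma cinner_diff_left: "cinner (x - y) z = cinner x z - cinner y z"
  using cinner_add_left[of x "-y" z] by (simp add: cinner_minus_left)

lemma cinner_diff_right: "cinner x (y - z) = cinner x y - cinner x z"
  using cinner_add_right[of x y "-z"] by (simp add: cinner_minus_right)

lemma norm_add_cinner: "(norm (x + y))\<^sup>2 = (norm x)\<^sup>2 + 2 * Re (cinner x y) + (norm y)\<^sup>2"
proof -
  have "complex_of_real ((norm (x + y))\<^sup>2) = cinner (x + y) (x + y)"
    by (rule cinner_self[symmetric])
  also have "\<dots> = cinner x x + (cinner x y + cinner y x) + cinner y y"
    by (simp add: cinner_add_left cinner_add_right)
  also have "cinner x y + cinner y x = of_real (2 * Re (cinner x y))"
    by (subst (2) cinner_commute) (simp add: complex_add_cnj)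
  finally show ?thesis
    by (simp only: cinner_self of_real_add[symmetric] of_real_eq_iff)
qed

lemma cinner_eq_left_unique:
  assumes "\<And>x. cinner x y = cinner x z"
  shows "y = z"
proof -
  have "cinner (y - z) (y - z) = 0" by (simp add: cinner_diff_right assms)
  then show ?thesis by (simp add: cinner_self)
qed

lemma cadjoint_unique:
  assumes "\<And>x y. cinner (A x) y = cinner x (B y)"
  shows "cadjoint A = B"
  unfolding cadjoint_def
proof (rule the_equality)
  show "\<forall>x y. cinner (A x) y = cinner x (B y)" using assms by blast
next
  fix C assume C: "\<forall>x y. cinner (A x) y = cinner x (C y)"
  show "C = B"
  proof
    fix y show "C y = B y" by (rule cinner_eq_left_unique) (metis C assms)
  qed
qed

text \<open>The representing vector of a functional \<open>f\<close> minimizes \<open>\<parallel>x\<parallel>\<^sup>2 - 2 Re f(x)\<close>.\<close>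

lemma riesz_representation:
  fixes f :: "'a::chilbert_space \<Rightarrow> complex"
  assumes f: "bounded_linear f" and fC: "\<And>c x. f (c *\<^sub>C x) = c * f x"
  obtains u where "\<And>x. f x = cinner x u"
proof -
  interpret f: bounded_linear f by (rule f)
  define \<Phi> where "\<Phi> x = (norm x)\<^sup>2 - 2 * Re (f x)" for x
  obtain K where K: "\<And>x. norm (f x) \<le> norm x * K" using f.bounded by blast
  have lower: "\<Phi> x \<ge> - K\<^sup>2" for x
  proof -
    have "Re (f x) \<le> norm x * K" using K[of x] complex_Re_le_cmod[of "f x"] by linarith
    moreover have "(norm x - K)\<^sup>2 \<ge> 0" by simp
    ultimately show ?thesis unfolding \<Phi>_def by (simp add: power2_diff)
  qed
  define m where "m = Inf (range \<Phi>)"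
  have bdd: "bdd_below (range \<Phi>)" by (rule bdd_belowI2[where m="- K\<^sup>2"]) (use lower in blast)
  have m_le: "m \<le> \<Phi> x" for x unfolding m_def by (rule cInf_lower) (use bdd in auto)
  have "\<exists>x. \<Phi> x < m + inverse (real (Suc n))" for n
  proof -
    have "Inf (range \<Phi>) < m + inverse (real (Suc n))" unfolding m_def by simp
    then show ?thesis using cInf_lessD[of "range \<Phi>"] by blast
  qed
  then obtain X where X: "\<And>n. \<Phi> (X n) < m + inverse (real (Suc n))" by metis
  have par: "(norm (x - y))\<^sup>2 \<le> 2 * (\<Phi> x - m) + 2 * (\<Phi> y - m)" for x y
  proof -
    have 1: "(norm (x - y))\<^sup>2 + (norm (x + y))\<^sup>2 = 2 * (norm x)\<^sup>2 + 2 * (norm y)\<^sup>2"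
      using norm_add_cinner[of x y] norm_add_cinner[of x "-y"] by (simp add: cinner_minus_right)
    have n: "(norm ((1/2) *\<^sub>R (x + y)))\<^sup>2 = (norm (x + y))\<^sup>2 / 4"
      unfolding norm_scaleR by (simp add: power_mult_distrib power2_eq_square)
    have f2: "f ((1/2) *\<^sub>R (x + y)) = (1/2) *\<^sub>R (f x + f y)"
      by (simp only: f.scaleR f.add)
    have 2: "\<Phi> ((1/2) *\<^sub>R (x + y)) = (norm (x + y))\<^sup>2 / 4 - Re (f x) - Re (f y)"
      unfolding \<Phi>_def n f2 by (simp add: field_simps)
    show ?thesis using 1 m_le[of "(1/2) *\<^sub>R (x + y)"] unfolding 2 unfolding \<Phi>_def by argo
  qed
  have "Cauchy X"
  proof (rule metric_CauchyI)
    fix e :: real assume "e > 0"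
    then have "e\<^sup>2 / 4 > 0" by simp
    then obtain N where N: "inverse (real (Suc N)) < e\<^sup>2 / 4" using reals_Archimedean by blast
    have *: "\<Phi> (X n) - m < e\<^sup>2 / 4" if "n \<ge> N" for n
    proof -
      have "inverse (real (Suc n)) \<le> inverse (real (Suc N))"
        using that by (intro le_imp_inverse_le) auto
      then show ?thesis using X[of n] N by linarith
    qed
    have "dist (X k) (X n) < e" if "k \<ge> N" "n \<ge> N" for k n
    proof -
      have "(norm (X k - X n))\<^sup>2 < e\<^sup>2" using par[of "X k" "X n"] *[OF that(1)] *[OF that(2)] by argo
      then show ?thesis using \<open>e > 0\<close> by (simp add: dist_norm power_less_imp_less_base)
    qed
    then show "\<exists>M. \<forall>k\<ge>M. \<forall>n\<ge>M. dist (X k) (X n) < e" by blast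
  qed
  then obtain u where u: "X \<longlonglongrightarrow> u" using Cauchy_convergent convergent_def by blast
  have "(\<lambda>n. \<Phi> (X n)) \<longlonglongrightarrow> \<Phi> u"
    unfolding \<Phi>_def by (intro tendsto_intros u f.tendsto)
  moreover have "(\<lambda>n. m + inverse (real (Suc n))) \<longlonglongrightarrow> m + 0"
    by (intro tendsto_add tendsto_const LIMSEQ_inverse_real_of_nat)
  ultimately have "\<Phi> u \<le> m + 0"
    by (rule LIMSEQ_le) (use X less_imp_le in blast)
  then have min: "\<Phi> u \<le> \<Phi> x" for x using m_le[of x] by simp
  have re: "Re (f v) = Re (cinner u v)" for v
  proof -
    define a where "a = Re (cinner u v) - Re (f v)"
    have *: "0 \<le> 2 * t * a + t\<^sup>2 * (norm v)\<^sup>2" for t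
      using min[of "u + t *\<^sub>R v"] norm_add_cinner[of u "t *\<^sub>R v"] unfolding \<Phi>_def a_def
      by (simp add: f.add f.scaleR cinner_scaleR_right power_mult_distrib algebra_simps)
    have "a = 0"
    proof (rule ccontr)
      assume "a \<noteq> 0"
      define s where "s = (norm v)\<^sup>2 + 1"
      have s: "s \<ge> 1" by (simp add: s_def)
      have "0 \<le> 2 * (- a / s) * a + (- a / s)\<^sup>2 * (norm v)\<^sup>2" by (rule *)
      also have "\<dots> = (a\<^sup>2 / s\<^sup>2) * ((norm v)\<^sup>2 - 2 * s)"
        using s by (simp add: field_simps power2_eq_square)
      also have "\<dots> < 0"
      proof (rule mult_pos_neg)
        show "0 < a\<^sup>2 / s\<^sup>2" using \<open>a \<noteq> 0\<close> s by simp
        show "(norm v)\<^sup>2 - 2 * s < 0" unfolding s_def using zero_le_power2[of "norm v"] by argo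
      qed
      finally show False by simp
    qed
    then show ?thesis by (simp add: a_def)
  qed
  have "f x = cinner x u" for x
  proof (rule complex_eqI)
    have sw: "cinner x u = cnj (cinner u x)" for x by (rule cinner_commute)
    show "Re (f x) = Re (cinner x u)" using re[of x] sw[of x] by simp
    show "Im (f x) = Im (cinner x u)"
      using re[of "\<i> *\<^sub>C x"] sw[of x] by (simp add: fC cinner_scaleC_right)
  qed
  then show thesis using that by blast
qed

lemma cinner_cauchy_schwarz: "cmod (cinner x y) \<le> norm x * norm y"
proof (cases "y = 0")
  case True
  then show ?thesis using cinner_scaleR_right[of x 0 0] by simp
next
  case False
  define c where "c = cinner x y"
  define n where "n = (norm y)\<^sup>2"
  have n: "n > 0" using False by (simp add: n_def)
  define z where "z = (- (c / of_real n)) *\<^sub>C y"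
  have 1: "(norm z)\<^sup>2 = (cmod c)\<^sup>2 / n"
  proof -
    have "complex_of_real ((norm z)\<^sup>2) = (- (c / of_real n)) * (cnj (- (c / of_real n)) * of_real n)"
      unfolding z_def by (simp only: cinner_self[symmetric] cinner_scaleC_left cinner_scaleC_right)
        (simp add: cinner_self n_def)
    also have "\<dots> = (c * cnj c) / of_real n" using n by simp
    also have "\<dots> = of_real ((cmod c)\<^sup>2 / n)" by (simp add: complex_norm_square del: of_real_power)
    finally show ?thesis by (simp only: of_real_eq_iff)
  qed
  have 2: "Re (cinner x z) = - ((cmod c)\<^sup>2 / n)"
  proof -
    have "cinner x z = - (cnj c * c / of_real n)"
      unfolding z_def by (simp add: cinner_scaleC_right c_def[symmetric])
    also have "\<dots> = of_real (- ((cmod c)\<^sup>2 / n))" by (simp add: mult.commute complex_norm_square del: of_real_power)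
    finally show ?thesis by simp
  qed
  have "0 \<le> (norm (x + z))\<^sup>2" by simp
  also have "\<dots> = (norm x)\<^sup>2 - (cmod c)\<^sup>2 / n" by (simp add: norm_add_cinner 1 2)
  finally have "(cmod c)\<^sup>2 \<le> (norm x * norm y)\<^sup>2"
    using n by (simp add: field_simps n_def)
  then show ?thesis unfolding c_def by (rule power2_le_imp_le) simp
qed

lemma bounded_linear_cinner_left: "bounded_linear (\<lambda>x. cinner x y)"
  by (rule bounded_linear_intro[where K="norm y"])
    (auto simp: cinner_add_left cinner_scaleR_left scaleR_conv_of_real cinner_cauchy_schwarz)

lemma cadjoint_works:
  fixes A :: "'a::chilbert_space \<Rightarrow> 'b::complex_inner"
  assumes "bounded_clinear A"
  shows "cinner (A x) y = cinner x (cadjoint A y)"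
proof -
  have "\<exists>u. \<forall>x. cinner (A x) y = cinner x u" for y
  proof -
    have "bounded_linear (\<lambda>x. cinner (A x) y)"
      using assms bounded_linear_compose[OF bounded_linear_cinner_left]
      unfolding bounded_clinear_def by blast
    then show ?thesis
      by (rule riesz_representation) (use assms in \<open>auto simp: bounded_clinear_def cinner_scaleC_left\<close>)
  qed
  then obtain B where B: "\<And>x y. cinner (A x) y = cinner x (B y)" by metis
  then have "cadjoint A = B" by (rule cadjoint_unique)
  with B show ?thesis by simp
qed

section \<open>The Hilbert space of square-summable families\<close>

typedef 'a ell2 = "{f :: 'a \<Rightarrow> complex. (\<lambda>i. (cmod (f i))\<^sup>2) summable_on UNIV}"
  morphisms ell2_coeff Abs_ell2
  by (rule exI[where x="\<lambda>_. 0"]) simp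

setup_lifting type_definition_ell2

lemma coeff_summable: "(\<lambda>i. (cmod (ell2_coeff f i))\<^sup>2) summable_on A"
  using ell2_coeff[of f] by (auto intro: summable_on_subset_banach)

lemma square_summableI:
  assumes "\<And>F. finite F \<Longrightarrow> (\<Sum>i\<in>F. (cmod (f i))\<^sup>2) \<le> C"
  shows "(\<lambda>i. (cmod (f i))\<^sup>2) summable_on A"
  by (rule nonneg_bdd_above_summable_on) (auto intro!: bdd_aboveI2[where M=C] assms)

lemma square_summable_add:
  fixes f g :: "'a \<Rightarrow> complex"
  assumes "(\<lambda>i. (cmod (f i))\<^sup>2) summable_on UNIV" "(\<lambda>i. (cmod (g i))\<^sup>2) summable_on UNIV"
  shows "(\<lambda>i. (cmod (f i + g i))\<^sup>2) summable_on UNIV"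
proof (rule summable_on_comparison_test)
  show "(\<lambda>i. 2 * (cmod (f i))\<^sup>2 + 2 * (cmod (g i))\<^sup>2) summable_on UNIV"
    by (intro summable_on_add summable_on_cmult_right assms)
  fix i
  have "(cmod (f i + g i))\<^sup>2 \<le> (cmod (f i) + cmod (g i))\<^sup>2"
    by (intro power_mono norm_triangle_ineq) simp
  also have "\<dots> \<le> 2 * (cmod (f i))\<^sup>2 + 2 * (cmod (g i))\<^sup>2"
    using sum_squares_bound[of "cmod (f i)" "cmod (g i)"] by (simp add: power2_sum)
  finally show "(cmod (f i + g i))\<^sup>2 \<le> 2 * (cmod (f i))\<^sup>2 + 2 * (cmod (g i))\<^sup>2" .
qed auto

lemma square_summable_scale:
  "(\<lambda>i. (cmod (f i))\<^sup>2) summable_on UNIV \<Longrightarrow> (\<lambda>i. (cmod (c * f i))\<^sup>2) summable_on UNIV"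
  by (simp add: norm_mult power_mult_distrib summable_on_cmult_right)

lemma coeff_mult_summable: "(\<lambda>i. ell2_coeff f i * cnj (ell2_coeff g i)) summable_on UNIV"
proof (rule abs_summable_summable, rule summable_on_comparison_test)
  show "(\<lambda>i. (cmod (ell2_coeff f i))\<^sup>2 + (cmod (ell2_coeff g i))\<^sup>2) summable_on UNIV"
    by (intro summable_on_add coeff_summable)
  fix i
  have "0 \<le> cmod (ell2_coeff f i) * cmod (ell2_coeff g i)" by simp
  then show "norm (ell2_coeff f i * cnj (ell2_coeff g i)) \<le> (cmod (ell2_coeff f i))\<^sup>2 + (cmod (ell2_coeff g i))\<^sup>2"
    using sum_squares_bound[of "cmod (ell2_coeff f i)" "cmod (ell2_coeff g i)"]
    unfolding norm_mult complex_mod_cnj by argo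
qed auto

instantiation ell2 :: (type) complex_inner
begin

lift_definition zero_ell2 :: "'a ell2" is "\<lambda>_. 0" by simp
lift_definition plus_ell2 :: "'a ell2 \<Rightarrow> 'a ell2 \<Rightarrow> 'a ell2" is "\<lambda>f g i. f i + g i"
  by (rule square_summable_add)
lift_definition uminus_ell2 :: "'a ell2 \<Rightarrow> 'a ell2" is "\<lambda>f i. - f i" by simp
definition minus_ell2 :: "'a ell2 \<Rightarrow> 'a ell2 \<Rightarrow> 'a ell2" where "minus_ell2 f g = f + (- g)"
lift_definition scaleC_ell2 :: "complex \<Rightarrow> 'a ell2 \<Rightarrow> 'a ell2" is "\<lambda>c f i. c * f i"
  by (rule square_summable_scale)
definition scaleR_ell2 :: "real \<Rightarrow> 'a ell2 \<Rightarrow> 'a ell2" where "scaleR_ell2 r f = complex_of_real r *\<^sub>C f"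
definition cinner_ell2 :: "'a ell2 \<Rightarrow> 'a ell2 \<Rightarrow> complex" where
  "cinner_ell2 f g = (\<Sum>\<^sub>\<infinity>i. ell2_coeff f i * cnj (ell2_coeff g i))"
definition norm_ell2 :: "'a ell2 \<Rightarrow> real" where
  "norm_ell2 f = sqrt (\<Sum>\<^sub>\<infinity>i. (cmod (ell2_coeff f i))\<^sup>2)"
definition dist_ell2 :: "'a ell2 \<Rightarrow> 'a ell2 \<Rightarrow> real" where "dist_ell2 f g = norm (f - g)"
definition sgn_ell2 :: "'a ell2 \<Rightarrow> 'a ell2" where "sgn_ell2 f = inverse (norm f) *\<^sub>R f"
definition uniformity_ell2 :: "('a ell2 \<times> 'a ell2) filter" where
  "uniformity_ell2 = (INF e\<in>{0 <..}. principal {(f, g). dist f g < e})"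
definition open_ell2 :: "'a ell2 set \<Rightarrow> bool" where
  "open_ell2 U = (\<forall>f\<in>U. \<forall>\<^sub>F (f', g) in uniformity. f' = f \<longrightarrow> g \<in> U)"

lemma norm_ell2_le_iff:
  fixes f :: "'a ell2"
  assumes "C \<ge> 0"
  shows "norm f \<le> C \<longleftrightarrow> (\<forall>F. finite F \<longrightarrow> L2_set (\<lambda>i. cmod (ell2_coeff f i)) F \<le> C)"
proof
  assume le: "norm f \<le> C"
  show "\<forall>F. finite F \<longrightarrow> L2_set (\<lambda>i. cmod (ell2_coeff f i)) F \<le> C"
  proof (intro allI impI)
    fix F :: "'a set" assume "finite F"
    then have "(\<Sum>i\<in>F. (cmod (ell2_coeff f i))\<^sup>2) \<le> (\<Sum>\<^sub>\<infinity>i. (cmod (ell2_coeff f i))\<^sup>2)"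
      by (intro finite_sum_le_infsum coeff_summable) auto
    then show "L2_set (\<lambda>i. cmod (ell2_coeff f i)) F \<le> C"
      using le unfolding L2_set_def norm_ell2_def using real_sqrt_le_mono order_trans by blast
  qed
next
  assume *: "\<forall>F. finite F \<longrightarrow> L2_set (\<lambda>i. cmod (ell2_coeff f i)) F \<le> C"
  have "(\<Sum>\<^sub>\<infinity>i. (cmod (ell2_coeff f i))\<^sup>2) \<le> C\<^sup>2"
  proof (rule infsum_le_finite_sums[OF coeff_summable])
    fix F :: "'a set" assume "finite F"
    then have "sqrt (\<Sum>i\<in>F. (cmod (ell2_coeff f i))\<^sup>2) \<le> C" using * unfolding L2_set_def by blast
    then show "(\<Sum>i\<in>F. (cmod (ell2_coeff f i))\<^sup>2) \<le> C\<^sup>2" by (rule sqrt_le_D)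
  qed
  then show "norm f \<le> C" unfolding norm_ell2_def using assms by (intro real_le_lsqrt) auto
qed

lemma L2_set_le_norm: "finite F \<Longrightarrow> L2_set (\<lambda>i. cmod (ell2_coeff f i)) F \<le> norm (f :: 'a ell2)"
  using norm_ell2_le_iff[of "norm f" f] unfolding norm_ell2_def by (simp add: infsum_nonneg)

lemma coeff_le_norm: "cmod (ell2_coeff f i) \<le> norm (f :: 'a ell2)"
  using L2_set_le_norm[of "{i}" f] by simp

lemma norm_ell2_nonneg: "0 \<le> norm (f :: 'a ell2)"
  unfolding norm_ell2_def by (simp add: infsum_nonneg)

lemma coeff_diff: "ell2_coeff (f - g :: 'a ell2) i = ell2_coeff f i - ell2_coeff g i"
  by (simp add: minus_ell2_def plus_ell2.rep_eq uminus_ell2.rep_eq)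

lemma cinner_self_ell2: "cinner f f = complex_of_real ((norm (f :: 'a ell2))\<^sup>2)"
proof -
  have "cinner f f = (\<Sum>\<^sub>\<infinity>i. complex_of_real ((cmod (ell2_coeff f i))\<^sup>2))"
    unfolding cinner_ell2_def by (intro infsum_cong) (simp only: complex_norm_square)
  also have "\<dots> = complex_of_real (\<Sum>\<^sub>\<infinity>i. (cmod (ell2_coeff f i))\<^sup>2)"
    by (intro infsumI has_sum_of_real has_sum_infsum coeff_summable)
  finally show ?thesis unfolding norm_ell2_def by (simp add: infsum_nonneg)
qed

instance
proof
  fix f g h :: "'a ell2" and c d :: complex and r s :: real
  show "f + g + h = f + (g + h)" by transfer (simp add: add.assoc)
  show "f + g = g + f" by transfer (simp add: add.commute)
  show "0 + f = f" by transfer simp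
  show "- f + f = 0" by transfer simp
  show "f - g = f + - g" by (simp add: minus_ell2_def)
  show C1: "c *\<^sub>C (f + g) = c *\<^sub>C f + c *\<^sub>C g" by transfer (simp add: distrib_left)
  show C2: "(c + d) *\<^sub>C f = c *\<^sub>C f + d *\<^sub>C f" by transfer (simp add: distrib_right)
  show C3: "c *\<^sub>C (d *\<^sub>C f) = (c * d) *\<^sub>C f" by transfer (simp add: mult.assoc)
  show "complex_of_real r *\<^sub>C f = r *\<^sub>R f" by (simp add: scaleR_ell2_def)
  show "r *\<^sub>R (f + g) = r *\<^sub>R f + r *\<^sub>R g"
    unfolding scaleR_ell2_def by transfer (simp add: distrib_left)
  show "(r + s) *\<^sub>R f = r *\<^sub>R f + s *\<^sub>R f"
    unfolding scaleR_ell2_def by transfer (simp add: distrib_right)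
  show "r *\<^sub>R s *\<^sub>R f = (r * s) *\<^sub>R f"
    unfolding scaleR_ell2_def by transfer (simp add: mult.assoc)
  show "1 *\<^sub>R f = f" unfolding scaleR_ell2_def by transfer simp
  show "dist f g = norm (f - g)" by (rule dist_ell2_def)
  show "sgn f = inverse (norm f) *\<^sub>R f" by (rule sgn_ell2_def)
  show "uniformity = (INF e\<in>{0 <..}. principal {(f, g :: 'a ell2). dist f g < e})"
    by (rule uniformity_ell2_def)
  show "open U = (\<forall>f\<in>U. \<forall>\<^sub>F (f', g) in uniformity. f' = f \<longrightarrow> g \<in> U)" for U :: "'a ell2 set"
    by (rule open_ell2_def)
  show "norm f = 0 \<longleftrightarrow> f = 0"
  proof
    assume "norm f = 0"
    then have "ell2_coeff f i = 0" for i using coeff_le_norm[of f i] by simp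
    then show "f = 0" by transfer auto
  next
    assume "f = 0" then show "norm f = 0" by (simp add: norm_ell2_def zero_ell2.rep_eq)
  qed
  show "norm (f + g) \<le> norm f + norm g"
  proof (subst norm_ell2_le_iff)
    show "0 \<le> norm f + norm g" by (simp add: norm_ell2_nonneg)
    show "\<forall>F. finite F \<longrightarrow> L2_set (\<lambda>i. cmod (ell2_coeff (f + g) i)) F \<le> norm f + norm g"
    proof (intro allI impI)
      fix F :: "'a set" assume F: "finite F"
      have "L2_set (\<lambda>i. cmod (ell2_coeff (f + g) i)) F
          \<le> L2_set (\<lambda>i. cmod (ell2_coeff f i) + cmod (ell2_coeff g i)) F"
        by (rule L2_set_mono) (auto simp: plus_ell2.rep_eq norm_triangle_ineq)
      also have "\<dots> \<le> L2_set (\<lambda>i. cmod (ell2_coeff f i)) F + L2_set (\<lambda>i. cmod (ell2_coeff g i)) F"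
        by (rule L2_set_triangle_ineq)
      also have "\<dots> \<le> norm f + norm g" by (intro add_mono L2_set_le_norm F)
      finally show "L2_set (\<lambda>i. cmod (ell2_coeff (f + g) i)) F \<le> norm f + norm g" .
    qed
  qed
  show "norm (r *\<^sub>R f) = \<bar>r\<bar> * norm f"
    unfolding norm_ell2_def scaleR_ell2_def scaleC_ell2.rep_eq
    by (simp add: norm_mult power_mult_distrib infsum_cmult_right' real_sqrt_mult)
  show "cinner f g = cnj (cinner g f)"
    unfolding cinner_ell2_def by (simp add: infsum_cnj[symmetric] mult.commute)
  show "cinner (f + g) h = cinner f h + cinner g h"
    unfolding cinner_ell2_def
    by (simp add: plus_ell2.rep_eq distrib_right infsum_add coeff_mult_summable)
  show "cinner (c *\<^sub>C f) g = c * cinner f g"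
    unfolding cinner_ell2_def
    by (simp add: scaleC_ell2.rep_eq mult.assoc infsum_cmult_right')
  show "cinner f f = complex_of_real ((norm f)\<^sup>2)" by (rule cinner_self_ell2)
qed

end

instance ell2 :: (type) chilbert_space
proof
  fix X :: "nat \<Rightarrow> 'a ell2" assume X: "Cauchy X"
  have Xe: "\<exists>N. \<forall>m\<ge>N. \<forall>n\<ge>N. norm (X m - X n) < e" if "e > 0" for e
    using X that unfolding Cauchy_def dist_ell2_def by blast
  have "Cauchy (\<lambda>n. ell2_coeff (X n) i)" for i
  proof (rule CauchyI)
    fix e :: real assume "e > 0"
    then obtain N where N: "\<forall>m\<ge>N. \<forall>n\<ge>N. norm (X m - X n) < e" using Xe by blast
    have "norm (ell2_coeff (X m) i - ell2_coeff (X n) i) < e" if "m \<ge> N" "n \<ge> N" for m n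
      using coeff_le_norm[of "X m - X n" i] N that by (fastforce simp: coeff_diff)
    then show "\<exists>M. \<forall>m\<ge>M. \<forall>n\<ge>M. norm (ell2_coeff (X m) i - ell2_coeff (X n) i) < e" by blast
  qed
  then have "\<forall>i. \<exists>l. (\<lambda>n. ell2_coeff (X n) i) \<longlonglongrightarrow> l" using Cauchy_convergent convergent_def by blast
  then obtain g where g: "\<And>i. (\<lambda>n. ell2_coeff (X n) i) \<longlonglongrightarrow> g i" by metis
  have tail: "\<exists>N. \<forall>n\<ge>N. \<forall>F. finite F \<longrightarrow> L2_set (\<lambda>i. cmod (ell2_coeff (X n) i - g i)) F \<le> e"
    if "e > 0" for e
  proof -
    obtain N where N: "\<forall>m\<ge>N. \<forall>n\<ge>N. norm (X m - X n) < e" using Xe[OF \<open>e > 0\<close>] by blast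
    have "L2_set (\<lambda>i. cmod (ell2_coeff (X n) i - g i)) F \<le> e" if "n \<ge> N" and F: "finite F" for n F
    proof (rule tendsto_upperbound)
      show "(\<lambda>m. L2_set (\<lambda>i. cmod (ell2_coeff (X n) i - ell2_coeff (X m) i)) F)
          \<longlonglongrightarrow> L2_set (\<lambda>i. cmod (ell2_coeff (X n) i - g i)) F"
        unfolding L2_set_def by (intro tendsto_intros g)
      have "L2_set (\<lambda>i. cmod (ell2_coeff (X n) i - ell2_coeff (X m) i)) F \<le> e" if "m \<ge> N" for m
        using L2_set_le_norm[OF F, of "X n - X m"] N \<open>n \<ge> N\<close> that by (fastforce simp: coeff_diff)
      then show "\<forall>\<^sub>F m in sequentially. L2_set (\<lambda>i. cmod (ell2_coeff (X n) i - ell2_coeff (X m) i)) F \<le> e"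
        unfolding eventually_sequentially by blast
    qed simp
    then show ?thesis by blast
  qed
  obtain N where N: "\<And>F. finite F \<Longrightarrow> L2_set (\<lambda>i. cmod (ell2_coeff (X N) i - g i)) F \<le> 1"
    using tail[of 1] by auto
  have "(\<lambda>i. (cmod (ell2_coeff (X N) i - g i))\<^sup>2) summable_on UNIV"
    by (rule square_summableI[where C="1\<^sup>2"], rule sqrt_le_D) (use N in \<open>simp add: L2_set_def\<close>)
  then have "(\<lambda>i. (cmod (- (ell2_coeff (X N) i - g i) + ell2_coeff (X N) i))\<^sup>2) summable_on UNIV"
    by (intro square_summable_add) (auto simp: coeff_summable norm_minus_commute)
  then have gs: "ell2_coeff (Abs_ell2 g) = g" by (subst Abs_ell2_inverse) auto
  have "X \<longlonglongrightarrow> Abs_ell2 g"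
  proof (rule metric_LIMSEQ_I)
    fix e :: real assume e: "e > 0"
    then have "e / 2 > 0" by simp
    then obtain N where N: "\<forall>n\<ge>N. \<forall>F. finite F \<longrightarrow> L2_set (\<lambda>i. cmod (ell2_coeff (X n) i - g i)) F \<le> e/2"
      using tail[of "e / 2"] by blast
    have "dist (X n) (Abs_ell2 g) < e" if "n \<ge> N" for n
    proof -
      have "norm (X n - Abs_ell2 g) \<le> e/2"
        using N that e by (subst norm_ell2_le_iff) (simp_all add: coeff_diff gs)
      then show ?thesis using e by (simp add: dist_ell2_def)
    qed
    then show "\<exists>no. \<forall>n\<ge>no. dist (X n) (Abs_ell2 g) < e" by blast
  qed
  then show "convergent X" by (auto simp: convergent_def)
qed


subsection \<open>The standard basis and operators permuting basis vectors\<close>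

lift_definition ket :: "'a \<Rightarrow> 'a ell2" is "\<lambda>i j. if j = i then 1 else 0"
  by (rule finite_nonzero_values_imp_summable_on) simp

lemma cinner_ket_left: "cinner (ket i) f = cnj (ell2_coeff f i)"
proof -
  have "cinner (ket i) f = (\<Sum>\<^sub>\<infinity>j\<in>{i}. cnj (ell2_coeff f j))"
    unfolding cinner_ell2_def by (rule infsum_cong_neutral) (auto simp: ket.rep_eq)
  then show ?thesis by simp
qed

lemma cinner_ket_ket: "cinner (ket i) (ket j) = (if i = j then 1 else 0)"
  by (simp add: cinner_ket_left ket.rep_eq)

lemma ell2_coeff_add: "ell2_coeff (f + g) i = ell2_coeff f i + ell2_coeff g i"
  by (rule arg_cong[where f="\<lambda>u. u i", OF plus_ell2.rep_eq])

lemma ell2_coeff_scaleC: "ell2_coeff (c *\<^sub>C f) i = c * ell2_coeff f i"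
  by (simp add: scaleC_ell2.rep_eq)

lemma ell2_coeff_sum: "ell2_coeff (\<Sum>x\<in>F. f x) i = (\<Sum>x\<in>F. ell2_coeff (f x) i)"
  by (induction F rule: infinite_finite_induct) (simp_all add: zero_ell2.rep_eq ell2_coeff_add)

lemma ell2_eqI: "(\<And>i. ell2_coeff f i = ell2_coeff g i) \<Longrightarrow> f = g"
  by (metis ell2_coeff_inject ext)

lemma has_sum_metric:
  fixes f :: "'a \<Rightarrow> 'b::{metric_space, comm_monoid_add}"
  shows "(f has_sum S) A \<longleftrightarrow> (\<forall>e>0. \<exists>F. finite F \<and> F \<subseteq> A \<and>
    (\<forall>F'. finite F' \<and> F \<subseteq> F' \<and> F' \<subseteq> A \<longrightarrow> dist (\<Sum>i\<in>F'. f i) S < e))"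
  unfolding has_sum_def tendsto_iff eventually_finite_subsets_at_top ..

lemma has_sum_ket: "((\<lambda>i. ell2_coeff f i *\<^sub>C ket i) has_sum f) UNIV"
  unfolding has_sum_metric
proof (intro allI impI)
  fix e :: real assume e: "e > 0"
  define s where "s = (\<Sum>\<^sub>\<infinity>i. (cmod (ell2_coeff f i))\<^sup>2)"
  have hs: "((\<lambda>i. (cmod (ell2_coeff f i))\<^sup>2) has_sum s) UNIV"
    unfolding s_def by (intro has_sum_infsum coeff_summable)
  then obtain F where F: "finite F"
    and *: "\<And>F'. finite F' \<Longrightarrow> F \<subseteq> F' \<Longrightarrow> dist (\<Sum>i\<in>F'. (cmod (ell2_coeff f i))\<^sup>2) s < e\<^sup>2"
    unfolding has_sum_metric using e by (metis subset_UNIV zero_less_power)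
  have "dist (\<Sum>i\<in>F'. ell2_coeff f i *\<^sub>C ket i) f < e" if F': "finite F'" "F \<subseteq> F'" for F'
  proof -
    define g where "g = (\<Sum>i\<in>F'. ell2_coeff f i *\<^sub>C ket i) - f"
    have g: "ell2_coeff g j = (if j \<in> F' then 0 else - ell2_coeff f j)" for j
    proof -
      have "(\<Sum>i\<in>F'. ell2_coeff f i * (if j = i then 1 else 0)) = (if j \<in> F' then ell2_coeff f j else 0)"
        using F' by (simp add: if_distrib[of "\<lambda>x. _ * x"] cong: if_cong)
      then show ?thesis
        unfolding g_def by (simp add: coeff_diff ell2_coeff_sum ell2_coeff_scaleC ket.rep_eq)
    qed
    have "(\<Sum>\<^sub>\<infinity>i. (cmod (ell2_coeff g i))\<^sup>2) = (\<Sum>\<^sub>\<infinity>i\<in>- F'. (cmod (ell2_coeff f i))\<^sup>2)"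
      by (rule infsum_cong_neutral) (auto simp: g)
    also have "\<dots> = s - (\<Sum>i\<in>F'. (cmod (ell2_coeff f i))\<^sup>2)"
      unfolding s_def using infsum_Un_disjoint[of "\<lambda>i. (cmod (ell2_coeff f i))\<^sup>2" F' "- F'"] F'
      by (simp add: coeff_summable)
    also have "\<dots> < e\<^sup>2" using *[OF F'] by (simp add: dist_real_def)
    finally have "norm g < sqrt (e\<^sup>2)" unfolding norm_ell2_def by (rule real_sqrt_less_mono)
    then show ?thesis using e by (simp add: g_def dist_norm)
  qed
  then show "\<exists>F. finite F \<and> F \<subseteq> UNIV \<and> (\<forall>F'. finite F' \<and> F \<subseteq> F' \<and> F' \<subseteq> UNIV \<longrightarrow>
      dist (\<Sum>i\<in>F'. ell2_coeff f i *\<^sub>C ket i) f < e)"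
    using F by blast
qed

text \<open>For \<open>\<phi>\<close> injective on \<open>A\<close>, this is the partial isometry that maps the basis vector at
  \<open>i\<close> to the one at \<open>\<phi> i\<close> if \<open>i \<in> A\<close>, and to \<open>0\<close> otherwise.\<close>

lift_definition ell2_map :: "('a \<Rightarrow> 'b) \<Rightarrow> 'a set \<Rightarrow> 'a ell2 \<Rightarrow> 'b ell2"
  is "\<lambda>\<phi> A f j. if j \<in> \<phi> ` A then f (inv_into A \<phi> j) else 0"
proof -
  fix \<phi> :: "'a \<Rightarrow> 'b" and A and f :: "'a \<Rightarrow> complex"
  assume f: "(\<lambda>i. (cmod (f i))\<^sup>2) summable_on UNIV"
  have "(\<lambda>i. (cmod (f i))\<^sup>2) summable_on inv_into A \<phi> ` \<phi> ` A"
    by (rule summable_on_subset_banach[OF f]) simp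
  then have "(\<lambda>j. (cmod (f (inv_into A \<phi> j)))\<^sup>2) summable_on \<phi> ` A"
    by (subst (asm) summable_on_reindex) (auto intro: inj_on_inv_into simp: o_def)
  then show "(\<lambda>j. (cmod (if j \<in> \<phi> ` A then f (inv_into A \<phi> j) else 0))\<^sup>2) summable_on UNIV"
    by (rule iffD1[OF summable_on_cong_neutral, rotated -1]) auto
qed

lemma norm_ell2_map_le: "norm (ell2_map \<phi> A f) \<le> norm f"
proof -
  have "(\<Sum>\<^sub>\<infinity>j. (cmod (ell2_coeff (ell2_map \<phi> A f) j))\<^sup>2)
      = (\<Sum>\<^sub>\<infinity>j\<in>\<phi> ` A. (cmod (ell2_coeff f (inv_into A \<phi> j)))\<^sup>2)"
    by (rule infsum_cong_neutral) (auto simp: ell2_map.rep_eq)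
  also have "\<dots> = (\<Sum>\<^sub>\<infinity>i\<in>inv_into A \<phi> ` \<phi> ` A. (cmod (ell2_coeff f i))\<^sup>2)"
    by (subst infsum_reindex) (auto intro: inj_on_inv_into simp: o_def)
  also have "\<dots> \<le> (\<Sum>\<^sub>\<infinity>i. (cmod (ell2_coeff f i))\<^sup>2)"
    by (rule infsum_mono2) (auto simp: coeff_summable)
  finally show ?thesis unfolding norm_ell2_def by (rule real_sqrt_le_mono)
qed

lemma bounded_clinear_ell2_map: "bounded_clinear (ell2_map \<phi> A)"
  unfolding bounded_clinear_def
proof
  show C: "\<forall>c f. ell2_map \<phi> A (c *\<^sub>C f) = c *\<^sub>C ell2_map \<phi> A f"
    by (auto intro!: ell2_eqI simp: ell2_map.rep_eq ell2_coeff_scaleC)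
  show "bounded_linear (ell2_map \<phi> A)"
  proof (rule bounded_linear_intro[where K=1])
    show "ell2_map \<phi> A (f + g) = ell2_map \<phi> A f + ell2_map \<phi> A g" for f g
      by (auto intro!: ell2_eqI simp: ell2_map.rep_eq ell2_coeff_add)
    show "ell2_map \<phi> A (r *\<^sub>R f) = r *\<^sub>R ell2_map \<phi> A f" for r f
      using C by (simp add: scaleC_of_real[symmetric])
    show "norm (ell2_map \<phi> A f) \<le> norm f * 1" for f by (simp add: norm_ell2_map_le)
  qed
qed

lemma ell2_map_ket:
  assumes "inj_on \<phi> A"
  shows "ell2_map \<phi> A (ket i) = (if i \<in> A then ket (\<phi> i) else 0)"
  using assms by (auto intro!: ell2_eqI simp: ell2_map.rep_eq ket.rep_eq zero_ell2.rep_eq)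

section \<open>Directed graphs and their path algebras\<close>

text \<open>The source and range of an edge are its \<^const>\<open>tail\<close> and its \<^const>\<open>head\<close>.\<close>

definition no_sinks :: "('v, 'e) pre_digraph \<Rightarrow> bool" where
  "no_sinks G \<longleftrightarrow> (\<forall>x\<in>verts G. \<exists>e\<in>arcs G. tail G e = x)"

text \<open>Paths are written from right to left: \<open>Edges [e\<^sub>k, \<dots>, e\<^sub>1]\<close> is the path \<open>e\<^sub>k\<dots>e\<^sub>1\<close>, whose source
  is the source of \<open>e\<^sub>1\<close> and whose range is the range of \<open>e\<^sub>k\<close>.\<close>

datatype ('v, 'e) gpath = Vertex 'v | Edges "'e list"

definition free_semigroupoid :: "('v, 'e) pre_digraph \<Rightarrow> ('v, 'e) gpath set" where
  "free_semigroupoid G = Vertex ` verts G \<union>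
    {Edges es | es. es \<noteq> [] \<and> set es \<subseteq> arcs G \<and> successively (\<lambda>f e. tail G f = head G e) es}"

fun path_range :: "('v, 'e) pre_digraph \<Rightarrow> ('v, 'e) gpath \<Rightarrow> 'v" where
  "path_range G (Vertex x) = x"
| "path_range G (Edges es) = head G (hd es)"

text \<open>The product \<open>e w\<close> of an edge \<open>e\<close> and an element \<open>w\<close>, for \<open>r(w) = s(e)\<close>.\<close>

fun cons_edge :: "'e \<Rightarrow> ('v, 'e) gpath \<Rightarrow> ('v, 'e) gpath" where
  "cons_edge e (Vertex x) = Edges [e]"
| "cons_edge e (Edges es) = Edges (e # es)"

definition path_algebra :: "('v, 'e) pre_digraph \<Rightarrow> (('v, 'e) gpath \<Rightarrow>\<^sub>0 complex) set" where
  "path_algebra G = {p. Poly_Mapping.keys p \<subseteq> free_semigroupoid G}"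

fun path_eval :: "('e \<Rightarrow> 'h \<Rightarrow> 'h) \<Rightarrow> ('v \<Rightarrow> 'h \<Rightarrow> 'h) \<Rightarrow> ('v, 'e) gpath \<Rightarrow> 'h \<Rightarrow> 'h" where
  "path_eval T P (Vertex x) = P x"
| "path_eval T P (Edges es) = foldr (\<lambda>e A. T e \<circ> A) es id"

definition poly_eval ::
  "('e \<Rightarrow> 'h \<Rightarrow> 'h::complex_inner) \<Rightarrow> ('v \<Rightarrow> 'h \<Rightarrow> 'h) \<Rightarrow> (('v, 'e) gpath \<Rightarrow>\<^sub>0 complex) \<Rightarrow> 'h \<Rightarrow> 'h"
where
  "poly_eval T P p h = (\<Sum>w\<in>Poly_Mapping.keys p. Poly_Mapping.lookup p w *\<^sub>C path_eval T P w h)"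

section \<open>The left regular representation\<close>

text \<open>\<open>H\<^sub>G\<close> is the space \<open>\<ell>\<^sup>2\<close> of the free semigroupoid. Since the latter is a proper subset of its
  type, \<open>H\<^sub>G\<close> is the closed subspace of \<open>\<ell>\<^sup>2\<close> of the whole type consisting of the families that
  vanish off the free semigroupoid. The operators below vanish on the orthogonal complement.\<close>

definition graph_space :: "('v, 'e) pre_digraph \<Rightarrow> ('v, 'e) gpath ell2 set" where
  "graph_space G = {f. \<forall>w. w \<notin> free_semigroupoid G \<longrightarrow> ell2_coeff f w = 0}"

definition left_creation :: "('v, 'e) pre_digraph \<Rightarrow> 'e \<Rightarrow> ('v, 'e) gpath ell2 \<Rightarrow> ('v, 'e) gpath ell2" where
  "left_creation G e = ell2_map (cons_edge e) {w \<in> free_semigroupoid G. path_range G w = tail G e}"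

definition vertex_projection :: "('v, 'e) pre_digraph \<Rightarrow> 'v \<Rightarrow> ('v, 'e) gpath ell2 \<Rightarrow> ('v, 'e) gpath ell2" where
  "vertex_projection G x = ell2_map id {w \<in> free_semigroupoid G. path_range G w = x}"

text \<open>The operator norm, on \<open>H\<^sub>G\<close>, of the image of \<open>p\<close> in the left regular representation; as in
  \<^const>\<open>onorm\<close>, the quotient is \<open>0\<close> for the zero vector.\<close>

definition path_norm :: "('v, 'e) pre_digraph \<Rightarrow> (('v, 'e) gpath \<Rightarrow>\<^sub>0 complex) \<Rightarrow> real" where
  "path_norm G p = (SUP f\<in>graph_space G.
     norm (poly_eval (left_creation G) (vertex_projection G) p f) / norm f)"

lemma bounded_linear_poly_eval:
  fixes T :: "'e \<Rightarrow> 'h \<Rightarrow> 'h::complex_inner"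
  assumes T: "\<And>e. bounded_clinear (T e)" and P: "\<And>x. bounded_clinear (P x)"
  shows "bounded_linear (poly_eval T P p)"
proof -
  have TP: "bounded_linear (T e)" "bounded_linear (P x)" for e x
    using T P by (auto simp: bounded_clinear_def)
  have "bounded_linear (foldr (\<lambda>e A. T e \<circ> A) es id)" for es
    by (induction es) (auto simp: id_def o_def intro: bounded_linear_compose TP bounded_linear_ident)
  then have pe: "bounded_linear (path_eval T P w)" for w
    by (cases w) (simp_all add: TP)
  have sc: "bounded_linear (\<lambda>h :: 'h. c *\<^sub>C h)" for c :: complex
  proof (rule bounded_linear_intro[where K="cmod c"])
    fix h k :: 'h and r :: real
    show "c *\<^sub>C (h + k) = c *\<^sub>C h + c *\<^sub>C k" by (rule scaleC_add_right)
    show "c *\<^sub>C r *\<^sub>R h = r *\<^sub>R c *\<^sub>C h"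
      by (simp add: scaleC_of_real[symmetric] scaleC_scaleC mult.commute)
    have "complex_of_real ((norm (c *\<^sub>C h))\<^sup>2) = of_real ((norm h * cmod c)\<^sup>2)"
      by (simp only: cinner_self[symmetric] cinner_scaleC_left cinner_scaleC_right)
        (simp add: cinner_self complex_norm_square[unfolded of_real_power] power_mult_distrib mult_ac)
    then have "(norm (c *\<^sub>C h))\<^sup>2 = (norm h * cmod c)\<^sup>2" by (simp only: of_real_eq_iff)
    then show "norm (c *\<^sub>C h) \<le> norm h * cmod c" by simp
  qed
  show ?thesis
    unfolding poly_eval_def
    by (intro bounded_linear_sum bounded_linear_compose[OF sc] pe)
qed

lemma bdd_above_path_norm:
  "bdd_above ((\<lambda>f. norm (poly_eval (left_creation G) (vertex_projection G) p f) / norm f) ` S)"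
proof -
  have "bounded_linear (poly_eval (left_creation G) (vertex_projection G) p)"
    by (rule bounded_linear_poly_eval)
      (simp_all add: left_creation_def vertex_projection_def bounded_clinear_ell2_map)
  then show ?thesis by (intro bdd_aboveI2) (rule le_onorm)
qed

lemma left_creation_ket:
  assumes "w \<in> free_semigroupoid G"
  shows "left_creation G e (ket w) = (if path_range G w = tail G e then ket (cons_edge e w) else 0)"
proof -
  have "inj_on (cons_edge e) {w \<in> free_semigroupoid G. path_range G w = tail G e}"
  proof (rule inj_onI)
    fix u v
    assume "u \<in> {w \<in> free_semigroupoid G. path_range G w = tail G e}"
      and "v \<in> {w \<in> free_semigroupoid G. path_range G w = tail G e}"
      and "cons_edge e u = cons_edge e v"
    then show "u = v" by (cases u; cases v) (auto simp: free_semigroupoid_def)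
  qed
  then show ?thesis using assms by (simp add: left_creation_def ell2_map_ket)
qed

lemma cons_edge_in_free_semigroupoid:
  assumes "w \<in> free_semigroupoid G" "e \<in> arcs G" "path_range G w = tail G e"
  shows "cons_edge e w \<in> free_semigroupoid G"
  using assms by (cases w) (auto simp: free_semigroupoid_def successively_Cons)

lemma left_creation_in_graph_space:
  assumes "e \<in> arcs G"
  shows "left_creation G e f \<in> graph_space G"
  using cons_edge_in_free_semigroupoid[OF _ assms]
  by (fastforce simp: graph_space_def left_creation_def ell2_map.rep_eq)

lemma ell2_coeff_vertex_projection:
  "ell2_coeff (vertex_projection G x f) w =
    (if w \<in> free_semigroupoid G \<and> path_range G w = x then ell2_coeff f w else 0)"
proof -
  have "inv_into A id w = w" if "w \<in> A" for A and w :: "('a, 'b) gpath"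
    using that inv_into_f_f[of id A w] by simp
  then show ?thesis by (simp add: vertex_projection_def ell2_map.rep_eq)
qed

lemma vertex_projection_ket:
  assumes "w \<in> free_semigroupoid G"
  shows "vertex_projection G x (ket w) = (if path_range G w = x then ket w else 0)"
  using assms by (simp add: vertex_projection_def ell2_map_ket)

lemma is_orthogonal_projection_vertex_projection: "is_orthogonal_projection (vertex_projection G x)"
  unfolding is_orthogonal_projection_def
proof (intro conjI)
  show "bounded_clinear (vertex_projection G x)"
    unfolding vertex_projection_def by (rule bounded_clinear_ell2_map)
  show "vertex_projection G x \<circ> vertex_projection G x = vertex_projection G x"
    by (intro ext ell2_eqI) (simp add: ell2_coeff_vertex_projection)
  show "cadjoint (vertex_projection G x) = vertex_projection G x"
    by (rule cadjoint_unique, unfold cinner_ell2_def, rule infsum_cong)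
      (simp add: ell2_coeff_vertex_projection)
qed

lemma range_vertex_projection:
  "range (vertex_projection G x) =
    {f. \<forall>w. \<not> (w \<in> free_semigroupoid G \<and> path_range G w = x) \<longrightarrow> ell2_coeff f w = 0}"
proof (intro subset_antisym subsetI)
  fix f assume f: "f \<in> {f. \<forall>w. \<not> (w \<in> free_semigroupoid G \<and> path_range G w = x) \<longrightarrow> ell2_coeff f w = 0}"
  have "vertex_projection G x f = f"
    using f by (intro ell2_eqI) (auto simp: ell2_coeff_vertex_projection)
  then show "f \<in> range (vertex_projection G x)" by (metis rangeI)
qed (auto simp: ell2_coeff_vertex_projection)

section \<open>Stabilized row contractions\<close>

text \<open>The series of operators converges in the strong operator topology.\<close>

definition row_contraction :: "'e set \<Rightarrow> ('e \<Rightarrow> 'h::complex_inner \<Rightarrow> 'h) \<Rightarrow> bool" where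
  "row_contraction E T \<longleftrightarrow>
    (\<forall>e\<in>E. bounded_clinear (T e) \<and> T e \<noteq> (\<lambda>_. 0)) \<and>
    (\<forall>h. (\<lambda>e. T e (cadjoint (T e) h)) summable_on E) \<and>
    operator_le (\<lambda>h. \<Sum>\<^sub>\<infinity>e\<in>E. T e (cadjoint (T e) h)) id"

definition stabilizes ::
  "('v, 'e) pre_digraph \<Rightarrow> ('v \<Rightarrow> 'h::complex_inner \<Rightarrow> 'h) \<Rightarrow> ('e \<Rightarrow> 'h \<Rightarrow> 'h) \<Rightarrow> bool"
where
  "stabilizes G P T \<longleftrightarrow>
    (\<forall>x\<in>verts G. is_orthogonal_projection (P x)) \<and>
    (\<forall>x\<in>verts G. \<forall>y\<in>verts G. x \<noteq> y \<longrightarrow> P x \<circ> P y = (\<lambda>_. 0)) \<and>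
    (\<forall>h. ((\<lambda>x. P x h) has_sum h) (verts G)) \<and>
    (\<forall>e\<in>arcs G. \<forall>x\<in>verts G. T e \<circ> P x \<in> {T e, \<lambda>_. 0} \<and> P x \<circ> T e \<in> {T e, \<lambda>_. 0}) \<and>
    (\<forall>e\<in>arcs G. P (head G e) \<circ> T e \<circ> P (tail G e) = T e)"

end

theory Submission
  imports Defs
begin

text \<open>The inequality follows from the Poisson kernel of the scaled row \<open>(r T\<^sub>e)\<close>, \<open>0 \<le> r < 1\<close>. With
  \<open>\<Delta> = I - r\<^sup>2 \<Sum>\<^sub>e T\<^sub>e T\<^sub>e\<^sup>*\<close>, a positive operator, it maps \<open>h\<close> to the family of vectors
  \<open>\<Delta>\<^sup>1\<^sup>/\<^sup>2 r\<^sup>n (T\<^sub>w)\<^sup>* h\<close>, where \<open>w\<close> runs over the free semigroupoid, \<open>n\<close> is the length of \<open>w\<close> and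
  \<open>T\<^sub>w\<close> is \<open>P\<^sub>x\<close> if \<open>w\<close> is a vertex \<open>x\<close>. This map is an isometry: a telescoping sum in which the
  remainder vanishes because of \<open>r < 1\<close> (lemma \<open>defect_components\<close>). Stabilization makes it
  intertwine the adjoint of \<open>p(r T)\<close> with the adjoint of \<open>p(L) \<otimes> I\<close>
  (lemma \<open>component_component\<close>). Therefore \<open>p(r T)\<close> has at most the norm of \<open>p(L)\<close>, and
  \<open>r \<rightarrow> 1\<close> gives the claim for \<open>T\<close>.

  Neither the square root of \<open>\<Delta>\<close> nor a Hilbert space tensor product needs to be constructed. The
  vectors \<open>r\<^sup>n (T\<^sub>w)\<^sup>* h\<close> are measured with the semi-inner product \<open>\<langle>\<Delta> h, k\<rangle>\<close> in place of the norm of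
  their images under \<open>\<Delta>\<^sup>1\<^sup>/\<^sup>2\<close>. As \<open>p\<close> is a finite combination of paths, finitely many components of
  the image of \<open>h\<close> under the adjoint of \<open>p(r T)\<close> depend on finitely many components of \<open>h\<close>. So a
  finite scalar matrix acts on vectors of a semi-inner product space, and its norm there does not
  exceed its norm on scalars (lemma \<open>scalar_contraction_on_vectors\<close>).\<close>

section \<open>Linear maps and adjoints\<close>

definition complex_linear :: "('a::complex_inner \<Rightarrow> 'b::complex_inner) \<Rightarrow> bool" where
  "complex_linear f \<longleftrightarrow> (\<forall>x y. f (x + y) = f x + f y) \<and> (\<forall>c x. f (c *\<^sub>C x) = c *\<^sub>C f x)"

lemma bounded_clinear_imp_complex_linear: "bounded_clinear f \<Longrightarrow> complex_linear f"
  by (auto simp: complex_linear_def bounded_clinear_def linear_add dest: bounded_linear.linear)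

lemma scaleC_zero_left [simp]: "0 *\<^sub>C (x :: 'a::complex_inner) = 0"
  using scaleC_of_real[of 0 x] by simp

lemma scaleC_zero_right [simp]: "c *\<^sub>C (0 :: 'a::complex_inner) = 0"
  by (metis scaleC_zero_left scaleC_scaleC mult_zero_right)

lemma scaleC_one [simp]: "1 *\<^sub>C (x :: 'a::complex_inner) = x"
  using scaleC_of_real[of 1 x] by simp

lemma scaleC_sum_right: "c *\<^sub>C (\<Sum>i\<in>I. f i :: 'a::complex_inner) = (\<Sum>i\<in>I. c *\<^sub>C f i)"
  by (induction I rule: infinite_finite_induct) (simp_all add: scaleC_add_right)

lemma scaleC_sum_left: "(\<Sum>i\<in>I. c i) *\<^sub>C (x :: 'a::complex_inner) = (\<Sum>i\<in>I. c i *\<^sub>C x)"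
  by (induction I rule: infinite_finite_induct) (simp_all add: scaleC_add_left)

lemma cinner_zero_left [simp]: "cinner 0 (x :: 'a::complex_inner) = 0"
  using cinner_scaleR_left[of 0 x x] by simp

lemma cinner_zero_right [simp]: "cinner (x :: 'a::complex_inner) 0 = 0"
  using cinner_scaleR_right[of x 0 x] by simp

lemma cinner_sum_left: "cinner (\<Sum>i\<in>I. f i) (x :: 'a::complex_inner) = (\<Sum>i\<in>I. cinner (f i) x)"
  by (induction I rule: infinite_finite_induct) (simp_all add: cinner_add_left)

lemma cinner_sum_right: "cinner (x :: 'a::complex_inner) (\<Sum>i\<in>I. f i) = (\<Sum>i\<in>I. cinner x (f i))"
  by (induction I rule: infinite_finite_induct) (simp_all add: cinner_add_right)

lemma complex_linear_zero:
  assumes "complex_linear f"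
  shows "f 0 = 0"
  using assms unfolding complex_linear_def by (metis scaleC_zero_left)

lemma complex_linear_combination:
  assumes "complex_linear f"
  shows "f (\<Sum>i\<in>I. c i *\<^sub>C x i) = (\<Sum>i\<in>I. c i *\<^sub>C f (x i))"
  using assms complex_linear_zero[OF assms]
  by (induction I rule: infinite_finite_induct) (simp_all add: complex_linear_def)

lemma complex_linear_compose:
  "complex_linear f \<Longrightarrow> complex_linear g \<Longrightarrow> complex_linear (\<lambda>x. f (g x))"
  by (simp add: complex_linear_def)

lemma complex_linear_cadjoint:
  fixes A :: "'a::chilbert_space \<Rightarrow> 'b::complex_inner"
  assumes "bounded_clinear A"
  shows "complex_linear (cadjoint A)"
  unfolding complex_linear_def
  by (intro conjI allI; rule cinner_eq_left_unique)
    (simp_all add: cadjoint_works[OF assms, symmetric] cinner_add_right cinner_scaleC_right)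

section \<open>Scalar matrices acting on vectors of a semi-inner product space\<close>

locale positive_form =
  fixes form :: "'a::complex_inner \<Rightarrow> 'a \<Rightarrow> complex"
  assumes form_add_left: "form (x + y) z = form x z + form y z"
    and form_scaleC_left: "form (c *\<^sub>C x) y = c * form x y"
    and form_commute: "form x y = cnj (form y x)"
    and form_nonneg: "0 \<le> Re (form x x)"
begin

lemma form_add_right: "form x (y + z) = form x y + form x z"
  by (metis form_add_left form_commute complex_cnj_add)

lemma form_scaleC_right: "form x (c *\<^sub>C y) = cnj c * form x y"
  by (metis form_scaleC_left form_commute complex_cnj_mult)

lemma form_zero_left: "form 0 y = 0"
  by (metis form_scaleC_left scaleC_zero_left mult_zero_left)

lemma form_sum_scaleC_left: "form (\<Sum>i\<in>I. c i *\<^sub>C x i) y = (\<Sum>i\<in>I. c i * form (x i) y)"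
  by (induction I rule: infinite_finite_induct)
    (simp_all add: form_zero_left form_add_left form_scaleC_left)

lemma form_self: "form x x = of_real (Re (form x x))"
proof (rule complex_eqI)
  show "Im (form x x) = Im (of_real (Re (form x x)))"
    using arg_cong[OF form_commute[of x x], of Im] by simp
qed simp

lemma form_null_vector:
  assumes "form u u = 0"
  shows "form x u = 0"
proof (rule ccontr)
  assume ne: "form x u \<noteq> 0"
  define n where "n = (cmod (form x u))\<^sup>2"
  have n: "n > 0" using ne by (simp add: n_def)
  \<comment> \<open>Moving from \<open>x\<close> far enough along \<open>u\<close> would make the form negative.\<close>
  define t where "t = (Re (form x x) + 1) / (2 * n)"
  define c where "c = - of_real t * form x u"
  have "Re (form (x + c *\<^sub>C u) (x + c *\<^sub>C u)) = Re (form x x) + 2 * Re (cnj c * form x u)"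
    using assms arg_cong[OF form_commute[of u x], of Re] arg_cong[OF form_commute[of u x], of Im]
    by (simp add: form_add_left form_add_right form_scaleC_left form_scaleC_right algebra_simps)
  also have "cnj c * form x u = - of_real (t * n)"
    by (simp add: c_def n_def complex_norm_square mult_ac del: of_real_power)
  also have "Re (form x x) + 2 * Re (- complex_of_real (t * n)) = - 1"
    using n by (simp add: t_def field_simps)
  finally show False using form_nonneg[of "x + c *\<^sub>C u"] by simp
qed

lemma form_pythagoras:
  assumes "form x u = 0"
  shows "Re (form (x + c *\<^sub>C u) (x + c *\<^sub>C u)) = Re (form x x) + (cmod c)\<^sup>2 * Re (form u u)"
proof -
  have "form u x = 0" using assms form_commute[of u x] by simp
  then have "form (x + c *\<^sub>C u) (x + c *\<^sub>C u) = form x x + (c * cnj c) * form u u"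
    using assms by (simp add: form_add_left form_add_right form_scaleC_left form_scaleC_right)
  also have "(c * cnj c) * form u u = of_real ((cmod c)\<^sup>2 * Re (form u u))"
    by (subst form_self) (simp add: complex_norm_square[symmetric] del: of_real_power)
  finally show ?thesis by simp
qed

text \<open>Tensoring a matrix with an identity does not raise its norm. In coordinates for an orthonormal
  basis of the span of the \<open>k v\<close> modulo null vectors, the conclusion is the sum of the scalar
  inequalities for the single coordinates. The proof finds the coordinates one at a time, by
  Gram--Schmidt: subtracting from all entries their components along one of them splits off a scalar
  instance from both sides, and leaves a family with fewer non-zero entries. The set \<open>U\<close> bounds the
  non-zero entries, to induct on.\<close>

lemma scalar_contraction_on_vectors:
  assumes U: "finite U"
    and scalar: "\<And>a :: 'v \<Rightarrow> complex.
      (\<Sum>w\<in>W. (cmod (\<Sum>v\<in>V. c w v * a v))\<^sup>2) \<le> M * (\<Sum>v\<in>V. (cmod (a v))\<^sup>2)"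
    and supp: "\<And>v. v \<notin> U \<Longrightarrow> k v = 0"
  shows "(\<Sum>w\<in>W. Re (form (\<Sum>v\<in>V. c w v *\<^sub>C k v) (\<Sum>v\<in>V. c w v *\<^sub>C k v)))
    \<le> M * (\<Sum>v\<in>V. Re (form (k v) (k v)))"
  using U supp
proof (induction U arbitrary: k rule: finite_induct)
  case empty
  then show ?case by (simp add: form_zero_left)
next
  case (insert u U)
  \<comment> \<open>For a null vector \<open>k u\<close>, the quotient is \<open>0\<close>; this is right, since \<open>k u\<close> is then orthogonal to
    everything.\<close>
  define a where "a v = (if v = u then 1 else form (k v) (k u) / form (k u) (k u))" for v
  define k' where "k' v = k v - a v *\<^sub>C k u" for v
  have k: "k v = k' v + a v *\<^sub>C k u" for v by (simp add: k'_def)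
  have supp': "k' v = 0" if "v \<notin> U" for v
    using that insert.prems[of v] by (cases "v = u") (simp_all add: k'_def a_def form_zero_left)
  have orth: "form (k' v) (k u) = 0" for v
  proof (cases "form (k u) (k u) = 0 \<or> v = u")
    case True
    then show ?thesis by (auto simp: form_null_vector k'_def a_def form_zero_left)
  next
    case False
    have "form (k v) (k u) = form (k' v) (k u) + a v * form (k u) (k u)"
      by (subst k) (simp add: form_add_left form_scaleC_left)
    then show ?thesis using False by (simp add: a_def)
  qed
  define x where "x w = (\<Sum>v\<in>V. c w v *\<^sub>C k' v)" for w
  have row: "(\<Sum>v\<in>V. c w v *\<^sub>C k v) = x w + (\<Sum>v\<in>V. c w v * a v) *\<^sub>C k u" for w
    by (subst k) (simp add: x_def scaleC_add_right scaleC_scaleC scaleC_sum_left sum.distrib)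
  have x_orth: "form (x w) (k u) = 0" for w
    by (simp add: x_def form_sum_scaleC_left orth)
  define s where "s = Re (form (k u) (k u))"
  have split: "Re (form (k v) (k v)) = Re (form (k' v) (k' v)) + (cmod (a v))\<^sup>2 * s" for v
    using form_pythagoras[OF orth, of v "a v", folded k] by (simp add: s_def)
  have "(\<Sum>w\<in>W. Re (form (\<Sum>v\<in>V. c w v *\<^sub>C k v) (\<Sum>v\<in>V. c w v *\<^sub>C k v)))
      = (\<Sum>w\<in>W. Re (form (x w) (x w))) + (\<Sum>w\<in>W. (cmod (\<Sum>v\<in>V. c w v * a v))\<^sup>2) * s"
    by (simp add: row form_pythagoras[OF x_orth] sum.distrib sum_distrib_right s_def)
  also have "\<dots> \<le> M * (\<Sum>v\<in>V. Re (form (k' v) (k' v))) + M * (\<Sum>v\<in>V. (cmod (a v))\<^sup>2) * s"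
    unfolding x_def
    by (intro add_mono mult_right_mono insert.IH supp' scalar) (simp_all add: s_def form_nonneg)
  also have "\<dots> = M * (\<Sum>v\<in>V. Re (form (k' v) (k' v)) + (cmod (a v))\<^sup>2 * s)"
    by (simp add: sum.distrib distrib_left mult.assoc flip: sum_distrib_right)
  also have "\<dots> = M * (\<Sum>v\<in>V. Re (form (k v) (k v)))"
    by (simp add: split)
  finally show ?case .
qed

end

section \<open>The left regular representation as a scalar matrix\<close>

lemma complex_linear_path_eval:
  assumes "\<And>e. complex_linear (T e)" and "\<And>x. complex_linear (P x)"
  shows "complex_linear (path_eval T P w)"
proof -
  have "complex_linear (foldr (\<lambda>e A. T e \<circ> A) es id)" for es
  proof (induction es)
    case (Cons e es)
    show ?case using complex_linear_compose[OF assms(1) Cons.IH] by (simp add: o_def)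
  qed (simp add: complex_linear_def)
  then show ?thesis by (cases w) (simp_all add: assms)
qed

lemma complex_linear_poly_eval:
  assumes "\<And>e. complex_linear (T e)" and "\<And>x. complex_linear (P x)"
  shows "complex_linear (poly_eval T P p)"
proof -
  have "complex_linear (path_eval T P w)" for w by (intro complex_linear_path_eval assms)
  then show ?thesis
    by (simp add: complex_linear_def poly_eval_def scaleC_add_right sum.distrib scaleC_sum_right
        scaleC_scaleC mult.commute)
qed

abbreviation regular_eval ::
  "('v, 'e) pre_digraph \<Rightarrow> (('v, 'e) gpath \<Rightarrow>\<^sub>0 complex) \<Rightarrow> ('v, 'e) gpath ell2 \<Rightarrow> ('v, 'e) gpath ell2"
where
  "regular_eval G \<equiv> poly_eval (left_creation G) (vertex_projection G)"

lemma complex_linear_left_creation: "complex_linear (left_creation G e)"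
  and complex_linear_vertex_projection: "complex_linear (vertex_projection G x)"
  by (simp_all add: left_creation_def vertex_projection_def bounded_clinear_ell2_map
      bounded_clinear_imp_complex_linear)

lemma complex_linear_regular_eval: "complex_linear (regular_eval G p)"
  by (intro complex_linear_poly_eval complex_linear_left_creation complex_linear_vertex_projection)

lemma norm_regular_eval_le:
  assumes "f \<in> graph_space G"
  shows "norm (regular_eval G p f) \<le> path_norm G p * norm f"
proof (cases "f = 0")
  case True
  then show ?thesis by (simp add: complex_linear_zero complex_linear_regular_eval)
next
  case False
  have "norm (regular_eval G p f) / norm f \<le> path_norm G p"
    unfolding path_norm_def by (rule cSUP_upper[OF assms bdd_above_path_norm])
  then show ?thesis using False by (simp add: field_simps)
qed

lemma path_norm_nonneg: "0 \<le> path_norm G p"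
proof -
  have "0 \<in> graph_space G" by (simp add: graph_space_def zero_ell2.rep_eq)
  from cSUP_upper[OF this bdd_above_path_norm] show ?thesis
    by (simp add: path_norm_def)
qed

lemma norm_ket_combination:
  assumes "finite W"
  shows "norm (\<Sum>w\<in>W. y w *\<^sub>C ket w) = L2_set (\<lambda>w. cmod (y w)) W"
proof -
  have "complex_of_real ((norm (\<Sum>w\<in>W. y w *\<^sub>C ket w))\<^sup>2) = (\<Sum>w\<in>W. y w * cnj (y w))"
    unfolding cinner_self[symmetric] using assms
    by (simp add: cinner_sum_left cinner_sum_right cinner_scaleC_left cinner_scaleC_right
        cinner_ket_ket mult.commute if_distrib[of "\<lambda>x. _ * x"] cong: if_cong)
  also have "\<dots> = complex_of_real (\<Sum>w\<in>W. (cmod (y w))\<^sup>2)"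
    by (simp add: complex_norm_square del: of_real_power)
  finally have "(norm (\<Sum>w\<in>W. y w *\<^sub>C ket w))\<^sup>2 = (\<Sum>w\<in>W. (cmod (y w))\<^sup>2)"
    by (simp only: of_real_eq_iff)
  then show ?thesis unfolding L2_set_def by (metis norm_ge_zero real_sqrt_unique)
qed

text \<open>A finite block of the matrix of \<open>p(L)\<^sup>*\<close> has at most the norm of \<open>p(L)\<close>: pair the image \<open>y\<close> of a
  column \<open>a\<close> with itself and move the block to the other side, where it becomes \<open>p(L)\<close>.\<close>

lemma adjoint_matrix_contraction:
  fixes p :: "('v, 'e) gpath \<Rightarrow>\<^sub>0 complex"
  assumes W: "finite W" "W \<subseteq> free_semigroupoid G" and V: "finite V"
  defines "c \<equiv> \<lambda>w v. cnj (ell2_coeff (regular_eval G p (ket w)) v)"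
  shows "(\<Sum>w\<in>W. (cmod (\<Sum>v\<in>V. c w v * a v))\<^sup>2) \<le> (path_norm G p)\<^sup>2 * (\<Sum>v\<in>V. (cmod (a v))\<^sup>2)"
proof -
  let ?M = "path_norm G p"
  define y where "y w = (\<Sum>v\<in>V. c w v * a v)" for w
  define f where "f = (\<Sum>w\<in>W. y w *\<^sub>C ket w)"
  define \<alpha> where "\<alpha> = L2_set (\<lambda>v. cmod (a v)) V"
  define \<beta> where "\<beta> = L2_set (\<lambda>w. cmod (y w)) W"
  have f: "f \<in> graph_space G"
    using W by (auto simp: graph_space_def f_def ell2_coeff_sum ell2_coeff_scaleC ket.rep_eq
        intro!: sum.neutral)
  have norm_f: "norm f = \<beta>" unfolding f_def \<beta>_def by (rule norm_ket_combination[OF W(1)])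
  have coeff: "ell2_coeff (regular_eval G p f) v = (\<Sum>w\<in>W. y w * cnj (c w v))" for v
    unfolding f_def complex_linear_combination[OF complex_linear_regular_eval]
    by (simp add: ell2_coeff_sum ell2_coeff_scaleC c_def)
  have "complex_of_real (\<beta>\<^sup>2) = (\<Sum>w\<in>W. cnj (y w) * y w)"
    by (simp add: \<beta>_def L2_set_def sum_nonneg complex_norm_square mult.commute del: of_real_power)
  also have "\<dots> = (\<Sum>w\<in>W. \<Sum>v\<in>V. cnj (y w) * c w v * a v)"
    by (subst (2) y_def) (simp add: sum_distrib_left mult.assoc)
  also have "\<dots> = (\<Sum>v\<in>V. \<Sum>w\<in>W. cnj (y w) * c w v * a v)" by (rule sum.swap)
  also have "\<dots> = (\<Sum>v\<in>V. a v * cnj (ell2_coeff (regular_eval G p f) v))"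
    by (simp add: coeff sum_distrib_left mult_ac)
  finally have "\<beta>\<^sup>2 = cmod (\<Sum>v\<in>V. a v * cnj (ell2_coeff (regular_eval G p f) v))"
    by (metis norm_of_real abs_power2)
  also have "\<dots> \<le> (\<Sum>v\<in>V. \<bar>cmod (a v)\<bar> * \<bar>cmod (ell2_coeff (regular_eval G p f) v)\<bar>)"
    by (rule order_trans[OF norm_sum]) (simp add: norm_mult)
  also have "\<dots> \<le> \<alpha> * L2_set (\<lambda>v. cmod (ell2_coeff (regular_eval G p f) v)) V"
    unfolding \<alpha>_def by (rule L2_set_mult_ineq)
  also have "\<dots> \<le> \<alpha> * (?M * \<beta>)"
    using L2_set_le_norm[OF V, of "regular_eval G p f"] norm_regular_eval_le[OF f, of p]
    by (intro mult_left_mono) (simp_all add: norm_f \<alpha>_def L2_set_nonneg)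
  finally have "\<beta> * \<beta> \<le> (?M * \<alpha>) * \<beta>" by (simp add: power2_eq_square mult_ac)
  moreover have "0 \<le> \<beta>" "0 \<le> ?M * \<alpha>"
    by (simp_all add: \<alpha>_def \<beta>_def L2_set_nonneg path_norm_nonneg)
  ultimately have "\<beta> \<le> ?M * \<alpha>" by (cases "\<beta> = 0") auto
  then have "\<beta>\<^sup>2 \<le> (?M * \<alpha>)\<^sup>2" using \<open>0 \<le> \<beta>\<close> by (rule power_mono)
  then show ?thesis
    by (simp add: \<alpha>_def \<beta>_def y_def L2_set_def sum_nonneg power_mult_distrib)
qed

section \<open>Paths by length\<close>

fun path_length :: "('v, 'e) gpath \<Rightarrow> nat" where
  "path_length (Vertex x) = 0"
| "path_length (Edges es) = length es"

definition short_paths :: "('v, 'e) pre_digraph \<Rightarrow> nat \<Rightarrow> ('v, 'e) gpath set" where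
  "short_paths G n = {w \<in> free_semigroupoid G. path_length w < n}"

lemma short_paths_Suc:
  assumes "wf_digraph G"
  shows "short_paths G (Suc n) = Vertex ` verts G \<union>
    (\<lambda>(e, w). cons_edge e w) ` (SIGMA e:arcs G. {w \<in> short_paths G n. path_range G w = tail G e})"
    (is "?L = ?V \<union> ?C")
proof (intro subset_antisym subsetI)
  fix w assume w: "w \<in> ?L"
  show "w \<in> ?V \<union> ?C"
  proof (cases w)
    case (Vertex x)
    then show ?thesis using w by (auto simp: short_paths_def free_semigroupoid_def)
  next
    case (Edges es)
    then obtain e fs where es: "es = e # fs"
      using w by (cases es) (auto simp: short_paths_def free_semigroupoid_def)
    have e: "e \<in> arcs G" using w by (auto simp: Edges es short_paths_def free_semigroupoid_def)
    define u where "u = (if fs = [] then Vertex (tail G e) else Edges fs)"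
    have "u \<in> short_paths G n" "path_range G u = tail G e" "w = cons_edge e u"
      using w wf_digraph.tail_in_verts[OF assms e]
      by (auto simp: Edges es u_def short_paths_def free_semigroupoid_def successively_Cons)
    then show ?thesis using e by force
  qed
next
  fix w assume "w \<in> ?V \<union> ?C"
  moreover have "path_length (cons_edge e u) = Suc (path_length u)" for e and u :: "('a, 'b) gpath"
    by (cases u) simp_all
  ultimately show "w \<in> ?L"
    by (auto simp: short_paths_def cons_edge_in_free_semigroupoid)
      (auto simp: free_semigroupoid_def)
qed

text \<open>The source of \<open>e\<close> determines which vertex \<open>w\<close> is if \<open>e w\<close> is the single edge \<open>e\<close>.\<close>

lemma inj_on_cons_edge:
  "inj_on (\<lambda>(e, w). cons_edge e w) (SIGMA e:arcs G. {w \<in> short_paths G n. path_range G w = tail G e})"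
proof (rule inj_onI, clarsimp)
  fix e f u v
  assume "u \<in> short_paths G n" "v \<in> short_paths G n" "cons_edge e u = cons_edge f v"
    "path_range G u = tail G e" "path_range G v = tail G f"
  then show "e = f \<and> u = v"
    by (cases u; cases v) (auto simp: short_paths_def free_semigroupoid_def)
qed

section \<open>The Poisson kernel of a stabilized row contraction\<close>

lemma has_sum_transfer:
  "(f has_sum s) A \<Longrightarrow> (\<And>x. x \<in> A \<Longrightarrow> g x = f x) \<Longrightarrow> (g has_sum s) A"
  by (simp cong: has_sum_cong)

text \<open>Scaling by \<open>r < 1\<close> makes the contributions of long paths decay geometrically. All adjoints
  are taken of \<open>T\<close> itself, and \<open>r\<close> enters as an explicit factor.\<close>

locale scaled_stabilized_row =
  fixes G :: "('v, 'e) pre_digraph"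
    and T :: "'e \<Rightarrow> 'h::chilbert_space \<Rightarrow> 'h"
    and P :: "'v \<Rightarrow> 'h \<Rightarrow> 'h"
    and r :: real
  assumes wf: "wf_digraph G"
    and row: "row_contraction (arcs G) T"
    and stab: "stabilizes G P T"
    and r_nonneg: "0 \<le> r" and r_less_one: "r < 1"
begin

definition row_square :: "'h \<Rightarrow> 'h" where
  "row_square h = (\<Sum>\<^sub>\<infinity>e\<in>arcs G. T e (cadjoint (T e) h))"

text \<open>The form of the defect operator \<open>I - \<Sum>\<^sub>e (r T\<^sub>e)(r T\<^sub>e)\<^sup>*\<close>.\<close>

definition defect_form :: "'h \<Rightarrow> 'h \<Rightarrow> complex" where
  "defect_form h k = cinner h k - of_real (r\<^sup>2) * cinner (row_square h) k"

definition scaled_adjoint :: "'e \<Rightarrow> 'h \<Rightarrow> 'h" where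
  "scaled_adjoint e h = r *\<^sub>R cadjoint (T e) h"

text \<open>The adjoint of the operator that the scaled row assigns to \<open>w\<close>. The Poisson kernel would also
  apply the square root of the defect operator; instead, components are measured with
  \<^const>\<open>defect_form\<close>.\<close>

fun component :: "('v, 'e) gpath \<Rightarrow> 'h \<Rightarrow> 'h" where
  "component (Vertex x) h = P x h"
| "component (Edges es) h = fold scaled_adjoint es h"

abbreviation defect :: "'h \<Rightarrow> real" where "defect h \<equiv> Re (defect_form h h)"

lemma clinear_T: "e \<in> arcs G \<Longrightarrow> bounded_clinear (T e)"
  using row by (simp add: row_contraction_def)

lemma cinner_T: "e \<in> arcs G \<Longrightarrow> cinner (T e h) k = cinner h (cadjoint (T e) k)"
  by (rule cadjoint_works[OF clinear_T])

lemma projection_P: "x \<in> verts G \<Longrightarrow> is_orthogonal_projection (P x)"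
  using stab by (simp add: stabilizes_def)

lemma cinner_P: "x \<in> verts G \<Longrightarrow> cinner (P x h) k = cinner h (P x k)"
  using cadjoint_works[of "P x" h k] projection_P[of x] by (simp add: is_orthogonal_projection_def)

lemma P_idem: "x \<in> verts G \<Longrightarrow> P x (P x h) = P x h"
  using projection_P[of x] by (metis is_orthogonal_projection_def comp_apply)

lemma P_orthogonal: "x \<in> verts G \<Longrightarrow> y \<in> verts G \<Longrightarrow> x \<noteq> y \<Longrightarrow> P x (P y h) = 0"
  using stab unfolding stabilizes_def by (metis comp_apply)

lemma verts_head: "e \<in> arcs G \<Longrightarrow> head G e \<in> verts G"
  and verts_tail: "e \<in> arcs G \<Longrightarrow> tail G e \<in> verts G"
  by (simp_all add: wf_digraph.head_in_verts[OF wf] wf_digraph.tail_in_verts[OF wf])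

lemma T_absorbs: "e \<in> arcs G \<Longrightarrow> T e h = P (head G e) (T e (P (tail G e) h))"
  using stab unfolding stabilizes_def by (metis comp_apply)

lemma T_after_tail: "e \<in> arcs G \<Longrightarrow> T e (P (tail G e) h) = T e h"
  by (metis T_absorbs P_idem verts_tail)

lemma head_after_T: "e \<in> arcs G \<Longrightarrow> P (head G e) (T e h) = T e h"
  by (metis T_absorbs P_idem verts_head)

lemma tail_after_cadjoint:
  assumes "e \<in> arcs G"
  shows "P (tail G e) (cadjoint (T e) h) = cadjoint (T e) h"
proof (rule cinner_eq_left_unique)
  fix y
  have "cinner y (P (tail G e) (cadjoint (T e) h)) = cinner (T e (P (tail G e) y)) h"
    using assms by (simp add: cinner_P[symmetric] cinner_T verts_tail)
  then show "cinner y (P (tail G e) (cadjoint (T e) h)) = cinner y (cadjoint (T e) h)"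
    using assms by (simp add: T_after_tail cinner_T)
qed

lemma cadjoint_after_P:
  assumes "e \<in> arcs G" "x \<in> verts G"
  shows "cadjoint (T e) (P x h) = (if x = head G e then cadjoint (T e) h else 0)"
proof (rule cinner_eq_left_unique)
  fix y
  have "cinner y (cadjoint (T e) (P x h)) = cinner (P x (T e y)) h"
    using assms by (simp add: cinner_P cinner_T)
  also have "P x (T e y) = (if x = head G e then T e y else 0)"
    using assms by (metis head_after_T P_orthogonal verts_head)
  finally show "cinner y (cadjoint (T e) (P x h))
      = cinner y (if x = head G e then cadjoint (T e) h else 0)"
    using assms by (simp add: cinner_T)
qed

lemma row_square_form:
  "((\<lambda>e. cinner (cadjoint (T e) h) (cadjoint (T e) k)) has_sum cinner (row_square h) k) (arcs G)"
proof -
  have "((\<lambda>e. T e (cadjoint (T e) h)) has_sum row_square h) (arcs G)"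
    unfolding row_square_def using row by (intro has_sum_infsum) (simp add: row_contraction_def)
  then have "((\<lambda>e. cinner (T e (cadjoint (T e) h)) k) has_sum cinner (row_square h) k) (arcs G)"
    by (rule has_sum_bounded_linear[OF bounded_linear_cinner_left])
  then show ?thesis by (rule has_sum_transfer) (simp add: cinner_T)
qed

lemma row_square_form_le: "Re (cinner (row_square h) h) \<le> (norm h)\<^sup>2"
proof -
  have "cinner (h - row_square h) h \<in> \<real>\<^sub>\<ge>\<^sub>0"
    using row by (simp add: row_contraction_def operator_le_def row_square_def)
  then show ?thesis
    by (simp add: complex_nonneg_Reals_iff cinner_diff_left cinner_self del: of_real_power)
qed

lemma linear_cadjoint: "e \<in> arcs G \<Longrightarrow> complex_linear (cadjoint (T e))"
  by (rule complex_linear_cadjoint[OF clinear_T])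

lemma scaled_adjoint_squares:
  "((\<lambda>e. (norm (scaled_adjoint e h))\<^sup>2) has_sum ((norm h)\<^sup>2 - defect h)) (arcs G)"
proof -
  have "((\<lambda>e. r\<^sup>2 * Re (cinner (cadjoint (T e) h) (cadjoint (T e) h))) has_sum
      r\<^sup>2 * Re (cinner (row_square h) h)) (arcs G)"
    by (intro has_sum_cmult_right has_sum_Re row_square_form)
  then show ?thesis
    by (simp add: defect_form_def scaled_adjoint_def cinner_self power_mult_distrib del: of_real_power)
qed

lemma defect_lower_bound: "(norm h)\<^sup>2 - defect h \<le> r\<^sup>2 * (norm h)\<^sup>2"
  using mult_left_mono[OF row_square_form_le, of "r\<^sup>2" h]
  by (simp add: defect_form_def cinner_self del: of_real_power)

sublocale positive_form defect_form
proof
  fix x y z :: 'h and c :: complex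
  have "cinner (row_square (x + y)) z = cinner (row_square x) z + cinner (row_square y) z"
  proof (rule has_sum_unique[OF row_square_form])
    show "((\<lambda>e. cinner (cadjoint (T e) (x + y)) (cadjoint (T e) z)) has_sum
        cinner (row_square x) z + cinner (row_square y) z) (arcs G)"
      by (rule has_sum_transfer[OF has_sum_add[OF row_square_form row_square_form]])
        (use linear_cadjoint in \<open>simp add: complex_linear_def cinner_add_left\<close>)
  qed
  then show "defect_form (x + y) z = defect_form x z + defect_form y z"
    by (simp add: defect_form_def cinner_add_left algebra_simps)
  have "cinner (row_square (c *\<^sub>C x)) y = c * cinner (row_square x) y"
  proof (rule has_sum_unique[OF row_square_form])
    show "((\<lambda>e. cinner (cadjoint (T e) (c *\<^sub>C x)) (cadjoint (T e) y)) has_sum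
        c * cinner (row_square x) y) (arcs G)"
      by (rule has_sum_transfer[OF has_sum_cmult_right[OF row_square_form]])
        (use linear_cadjoint in \<open>simp add: complex_linear_def cinner_scaleC_left\<close>)
  qed
  then show "defect_form (c *\<^sub>C x) y = c * defect_form x y"
    by (simp add: defect_form_def cinner_scaleC_left algebra_simps)
  have "cinner (row_square x) y = cnj (cinner (row_square y) x)"
  proof (rule has_sum_unique[OF row_square_form])
    show "((\<lambda>e. cinner (cadjoint (T e) x) (cadjoint (T e) y)) has_sum
        cnj (cinner (row_square y) x)) (arcs G)"
      using row_square_form[of y x] by (subst cinner_commute) simp
  qed
  then show "defect_form x y = cnj (defect_form y x)"
    using cinner_commute[of x y] by (simp add: defect_form_def)
  have "r\<^sup>2 \<le> 1" using r_nonneg r_less_one by (simp add: power_le_one)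
  then have "r\<^sup>2 * (norm x)\<^sup>2 \<le> 1 * (norm x)\<^sup>2" by (intro mult_right_mono) simp_all
  then show "0 \<le> defect x" using defect_lower_bound[of x] by simp
qed

text \<open>The defect operator commutes with every \<open>P x\<close>, because every product \<open>T\<^sub>e T\<^sub>e\<^sup>*\<close> does.\<close>

lemma defect_vertices: "((\<lambda>x. defect (P x h)) has_sum defect h) (verts G)"
proof -
  define d where "d = h - r\<^sup>2 *\<^sub>R row_square h"
  have d: "defect_form h y = cinner d y" for y
    by (simp add: d_def defect_form_def cinner_diff_left cinner_scaleR_left)
  have "defect (P x h) = Re (cinner (P x h) d)" if x: "x \<in> verts G" for x
  proof -
    have "cinner (row_square (P x h)) (P x h) = cinner (row_square h) (P x h)"
      by (rule has_sum_unique[OF row_square_form],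
          rule has_sum_transfer[OF row_square_form[of h "P x h"]])
        (simp add: cadjoint_after_P x)
    moreover have "cinner (P x h) (P x h) = cinner h (P x h)"
      by (simp add: cinner_P P_idem x)
    ultimately have "defect_form (P x h) (P x h) = cinner d (P x h)"
      by (simp add: defect_form_def flip: d)
    then show ?thesis by (subst cinner_commute) simp
  qed
  moreover have "((\<lambda>x. Re (cinner (P x h) d)) has_sum Re (cinner h d)) (verts G)"
    using stab unfolding stabilizes_def
    by (intro has_sum_Re has_sum_bounded_linear[OF bounded_linear_cinner_left]) blast
  moreover have "Re (cinner h d) = defect h" by (subst cinner_commute) (simp add: d)
  ultimately show ?thesis using has_sum_transfer by fastforce
qed

lemma component_after_P:
  assumes w: "w \<in> free_semigroupoid G" and x: "x \<in> verts G"
  shows "component w (P x h) = (if path_range G w = x then component w h else 0)"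
proof (cases w)
  case (Vertex y)
  then show ?thesis using w x by (auto simp: free_semigroupoid_def P_idem P_orthogonal)
next
  case (Edges es)
  then obtain f fs where es: "es = f # fs" "set es \<subseteq> arcs G"
    using w by (cases es) (auto simp: free_semigroupoid_def)
  have "fold scaled_adjoint fs 0 = 0"
    using es(2) unfolding es(1)
    by (induction fs) (simp_all add: scaled_adjoint_def complex_linear_zero linear_cadjoint)
  then show ?thesis using es x by (simp add: Edges scaled_adjoint_def[of f] cadjoint_after_P)
qed

lemma component_scaled_adjoint:
  assumes e: "e \<in> arcs G" and w: "w \<in> free_semigroupoid G"
  shows "component w (scaled_adjoint e h)
    = (if path_range G w = tail G e then component (cons_edge e w) h else 0)"
proof -
  have tail: "P (tail G e) (scaled_adjoint e h) = scaled_adjoint e h"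
    using projection_P[OF verts_tail[OF e]] tail_after_cadjoint[OF e]
    by (simp add: scaled_adjoint_def is_orthogonal_projection_def bounded_clinear_def
        linear_scale bounded_linear.linear)
  have "component w (scaled_adjoint e h)
      = (if path_range G w = tail G e then component w (scaled_adjoint e h) else 0)"
    using component_after_P[OF w verts_tail[OF e], of "scaled_adjoint e h"] by (simp add: tail)
  moreover have "component w (scaled_adjoint e h) = component (cons_edge e w) h"
    if "path_range G w = tail G e"
    using that by (cases w) (simp_all add: tail)
  ultimately show ?thesis by presburger
qed

text \<open>For \<open>n \<rightarrow> \<infinity>\<close> this says that the Poisson kernel is isometric. The sum telescopes in the path
  length: the squared norm of \<open>h\<close> is the defect of \<open>h\<close>, which the vertices account for, plus the
  squared norms of the vectors \<open>scaled_adjoint e h\<close>, whose components are those of \<open>h\<close> at the paths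
  whose last edge is \<open>e\<close>. Each further step in the length multiplies the bound on the remainder by \<open>r\<^sup>2\<close>.\<close>

lemma defect_components:
  "\<exists>R. 0 \<le> R \<and> R \<le> r ^ (2 * n) * (norm h)\<^sup>2 \<and>
    ((\<lambda>w. defect (component w h)) has_sum ((norm h)\<^sup>2 - R)) (short_paths G n)"
proof (induction n arbitrary: h)
  case 0
  then show ?case by (intro exI[of _ "(norm h)\<^sup>2"]) (simp add: short_paths_def)
next
  case (Suc n)
  have "\<exists>R. \<forall>h. 0 \<le> R h \<and> R h \<le> r ^ (2 * n) * (norm h)\<^sup>2 \<and>
      ((\<lambda>w. defect (component w h)) has_sum ((norm h)\<^sup>2 - R h)) (short_paths G n)"
    by (intro choice allI Suc.IH)
  then obtain R where "\<forall>h. 0 \<le> R h \<and> R h \<le> r ^ (2 * n) * (norm h)\<^sup>2 \<and>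
      ((\<lambda>w. defect (component w h)) has_sum ((norm h)\<^sup>2 - R h)) (short_paths G n)" ..
  note R = conjunct1[OF this[rule_format]] conjunct1[OF conjunct2[OF this[rule_format]]]
    conjunct2[OF conjunct2[OF this[rule_format]]]
  let ?A = "\<lambda>e. scaled_adjoint e h"
  let ?S = "\<lambda>e. {w \<in> short_paths G n. path_range G w = tail G e}"
  have sq: "((\<lambda>e. (norm (?A e))\<^sup>2) has_sum ((norm h)\<^sup>2 - defect h)) (arcs G)"
    by (rule scaled_adjoint_squares)
  have R_summable: "(\<lambda>e. R (?A e)) summable_on arcs G"
    by (rule summable_on_comparison_test[OF
          summable_on_cmult_right[OF has_sum_imp_summable[OF sq], of "r ^ (2 * n)"]])
      (simp_all add: R(1,2))
  define R' where "R' = (\<Sum>\<^sub>\<infinity>e\<in>arcs G. R (?A e))"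
  have R': "((\<lambda>e. R (?A e)) has_sum R') (arcs G)"
    unfolding R'_def by (rule has_sum_infsum[OF R_summable])
  have R'_nonneg: "0 \<le> R'" unfolding R'_def by (rule infsum_nonneg) (rule R(1))
  have "R' \<le> r ^ (2 * n) * ((norm h)\<^sup>2 - defect h)"
    by (rule has_sum_mono[OF R' has_sum_cmult_right[OF sq]]) (rule R(2))
  also have "\<dots> \<le> r ^ (2 * n) * (r\<^sup>2 * (norm h)\<^sup>2)"
    by (rule mult_left_mono[OF defect_lower_bound]) (simp add: r_nonneg)
  finally have R'_le: "R' \<le> r ^ (2 * Suc n) * (norm h)\<^sup>2"
    by (simp add: power2_eq_square mult_ac)
  have inner: "((\<lambda>w. defect (component (cons_edge e w) h)) has_sum ((norm (?A e))\<^sup>2 - R (?A e))) (?S e)"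
    if e: "e \<in> arcs G" for e
  proof -
    have "defect (component w (?A e)) = 0" if "w \<in> short_paths G n" "path_range G w \<noteq> tail G e" for w
      using that e by (simp add: short_paths_def component_scaled_adjoint form_zero_left)
    then have "((\<lambda>w. defect (component w (?A e))) has_sum ((norm (?A e))\<^sup>2 - R (?A e))) (?S e)"
      by (intro iffD1[OF has_sum_cong_neutral R(3)]) auto
    then show ?thesis
      by (rule has_sum_transfer)
        (simp add: short_paths_def component_scaled_adjoint e)
  qed
  have outer: "((\<lambda>e. (norm (?A e))\<^sup>2 - R (?A e)) has_sum ((norm h)\<^sup>2 - defect h - R')) (arcs G)"
    using has_sum_add[OF sq has_sum_uminusI[OF R']] by simp
  let ?f = "\<lambda>(e, w). defect (component (cons_edge e w) h)"
  have "(?f has_sum ((norm h)\<^sup>2 - defect h - R')) (Sigma (arcs G) ?S)"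
  proof (rule has_sum_SigmaI[OF _ outer])
    show "?f summable_on Sigma (arcs G) ?S"
      by (rule summable_on_SigmaI[OF _ has_sum_imp_summable[OF outer]])
        (simp_all add: inner form_nonneg)
  qed (simp add: inner)
  then have edges: "((\<lambda>w. defect (component w h)) has_sum ((norm h)\<^sup>2 - defect h - R'))
      ((\<lambda>(e, w). cons_edge e w) ` Sigma (arcs G) ?S)"
    by (subst has_sum_reindex[OF inj_on_cons_edge]) (simp add: o_def case_prod_unfold)
  have vertices: "((\<lambda>w. defect (component w h)) has_sum defect h) (Vertex ` verts G)"
    by (subst has_sum_reindex) (simp_all add: inj_on_def o_def defect_vertices)
  have "cons_edge e w \<noteq> Vertex x" for e :: 'e and w and x :: 'v by (cases w) simp_all
  then have disj: "Vertex ` verts G \<inter> (\<lambda>(e, w). cons_edge e w) ` Sigma (arcs G) ?S = {}"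
    by (auto simp: image_iff dest: sym)
  have "((\<lambda>w. defect (component w h)) has_sum ((norm h)\<^sup>2 - R')) (short_paths G (Suc n))"
    using has_sum_Un_disjoint[OF vertices edges disj] by (simp add: short_paths_Suc[OF wf])
  with R'_nonneg R'_le show ?case by (intro exI[of _ R'] conjI)
qed

text \<open>Being isometric, the Poisson kernel bounds finite sums of defects by the norm and, conversely,
  the norm by the finite sums.\<close>

lemma defect_components_le:
  assumes "finite V" "V \<subseteq> free_semigroupoid G"
  shows "(\<Sum>v\<in>V. defect (component v h)) \<le> (norm h)\<^sup>2"
proof -
  define n where "n = Suc (\<Sum>v\<in>V. path_length v)"
  have "path_length v < n" if "v \<in> V" for v
    using member_le_sum[OF that, of path_length] assms by (simp add: n_def)
  then have V: "V \<subseteq> short_paths G n" using assms by (auto simp: short_paths_def)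
  obtain R where R: "0 \<le> R"
    "((\<lambda>w. defect (component w h)) has_sum ((norm h)\<^sup>2 - R)) (short_paths G n)"
    using defect_components[of n h] by (elim exE conjE) (rule that)
  have "(\<Sum>v\<in>V. defect (component v h)) \<le> (norm h)\<^sup>2 - R"
    by (rule finite_sum_le_has_sum[OF R(2) assms(1) V]) (rule form_nonneg)
  then show ?thesis using R(1) by simp
qed

lemma norm_le_by_components:
  assumes "\<And>W. finite W \<Longrightarrow> W \<subseteq> free_semigroupoid G \<Longrightarrow> (\<Sum>w\<in>W. defect (component w g)) \<le> C"
  shows "(norm g)\<^sup>2 \<le> C"
proof -
  have "(norm g)\<^sup>2 - (r\<^sup>2) ^ n * (norm g)\<^sup>2 \<le> C" for n
  proof -
    obtain R where R: "R \<le> r ^ (2 * n) * (norm g)\<^sup>2"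
      "((\<lambda>w. defect (component w g)) has_sum ((norm g)\<^sup>2 - R)) (short_paths G n)"
      using defect_components[of n g] by (elim exE conjE) (rule that)
    have "short_paths G n \<subseteq> free_semigroupoid G" by (auto simp: short_paths_def)
    then have "(norm g)\<^sup>2 - R \<le> C"
      by (intro has_sum_le_finite_sums[OF R(2)] assms) blast+
    then show ?thesis using R(1) by (simp add: power_mult)
  qed
  moreover have "(\<lambda>n. (norm g)\<^sup>2 - (r\<^sup>2) ^ n * (norm g)\<^sup>2) \<longlonglongrightarrow> (norm g)\<^sup>2 - 0 * (norm g)\<^sup>2"
    using r_nonneg r_less_one
    by (intro tendsto_intros LIMSEQ_power_zero) (simp add: power_less_one_iff abs_square_less_1)
  ultimately have "(norm g)\<^sup>2 - 0 * (norm g)\<^sup>2 \<le> C" by (intro LIMSEQ_le_const2) blast+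
  then show ?thesis by simp
qed

text \<open>The Poisson kernel intertwines the adjoints of the scaled and of the left regular
  representation: if \<open>u\<close> and \<open>w\<close> can be concatenated, then \<open>v\<close> is \<open>u w\<close>, and otherwise both
  sides vanish.\<close>

lemma component_component:
  assumes u: "u \<in> free_semigroupoid G" and w: "w \<in> free_semigroupoid G"
  defines "L \<equiv> path_eval (left_creation G) (vertex_projection G) u (ket w)"
  shows "(L = 0 \<and> (\<forall>h. component w (component u h) = 0)) \<or>
    (\<exists>v\<in>free_semigroupoid G. L = ket v \<and> (\<forall>h. component w (component u h) = component v h))"
proof (cases u)
  case (Vertex x)
  then have x: "x \<in> verts G" using u by (auto simp: free_semigroupoid_def)
  then show ?thesis using w
    by (cases "path_range G w = x")
      (auto simp: L_def Vertex vertex_projection_ket component_after_P[OF w x])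
next
  case (Edges es)
  have "set es \<subseteq> arcs G" using u by (auto simp: Edges free_semigroupoid_def)
  then show ?thesis unfolding L_def Edges
  proof (induction es)
    case Nil
    then show ?case using w by auto
  next
    case (Cons e es)
    let ?L = "path_eval (left_creation G) (vertex_projection G) (Edges es) (ket w)"
    have e: "e \<in> arcs G" using Cons.prems by simp
    from Cons consider "?L = 0" "\<And>h. component w (component (Edges es) h) = 0"
      | v where "v \<in> free_semigroupoid G" "?L = ket v"
        "\<And>h. component w (component (Edges es) h) = component v h"
      by auto
    then show ?case
    proof cases
      case 1
      then show ?thesis by (simp add: complex_linear_zero complex_linear_left_creation)
    next
      case 2
      then show ?thesis using e
        by (auto simp: left_creation_ket component_scaled_adjoint cons_edge_in_free_semigroupoid)
    qed
  qed
qed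

lemma linear_component:
  assumes "w \<in> free_semigroupoid G"
  shows "complex_linear (component w)"
proof (cases w)
  case (Vertex x)
  then have "x \<in> verts G" using assms by (auto simp: free_semigroupoid_def)
  then show ?thesis using Vertex projection_P bounded_clinear_imp_complex_linear
    by (auto simp: is_orthogonal_projection_def complex_linear_def)
next
  case (Edges es)
  have A: "complex_linear (scaled_adjoint e)" if "e \<in> arcs G" for e
    using linear_cadjoint[OF that]
    by (simp add: scaled_adjoint_def complex_linear_def scaleC_add_right scaleC_scaleC mult.commute
        flip: scaleC_of_real)
  have "set es \<subseteq> arcs G" using assms by (auto simp: Edges free_semigroupoid_def)
  then have "complex_linear (fold scaled_adjoint es)"
  proof (induction es)
    case (Cons e es)
    then show ?case using complex_linear_compose[of "fold scaled_adjoint es" "scaled_adjoint e"]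
      by (simp add: A o_def)
  qed (simp add: complex_linear_def)
  then show ?thesis by (simp add: Edges complex_linear_def)
qed

lemma cinner_path_eval:
  assumes "w \<in> free_semigroupoid G"
  shows "cinner (r ^ path_length w *\<^sub>R path_eval T P w x) h = cinner x (component w h)"
proof (cases w)
  case (Vertex y)
  then show ?thesis using assms by (auto simp: free_semigroupoid_def cinner_P)
next
  case (Edges es)
  have "set es \<subseteq> arcs G" using assms by (auto simp: Edges free_semigroupoid_def)
  then have "cinner (r ^ length es *\<^sub>R path_eval T P (Edges es) x) h = cinner x (fold scaled_adjoint es h)"
  proof (induction es arbitrary: h)
    case (Cons e es)
    let ?y = "path_eval T P (Edges es) x"
    have "cinner (r ^ length (e # es) *\<^sub>R path_eval T P (Edges (e # es)) x) h
        = cinner (r ^ length es *\<^sub>R ?y) (scaled_adjoint e h)"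
      using Cons.prems
      by (simp add: scaled_adjoint_def cinner_scaleR_left cinner_scaleR_right cinner_T mult_ac)
    also have "\<dots> = cinner x (fold scaled_adjoint (e # es) h)" using Cons by simp
    finally show ?case .
  qed simp
  then show ?thesis by (simp add: Edges)
qed

text \<open>By the intertwining relation, the components of \<open>g h\<close> arise from those of \<open>h\<close> by the matrix of
  the adjoint of \<open>p(L)\<close>. On finite blocks this matrix is bounded by the norm of \<open>p(L)\<close>, also with
  vector entries, and the components determine the norms of \<open>g h\<close> and \<open>h\<close>.\<close>

lemma norm_adjoint_poly_le:
  assumes p: "p \<in> path_algebra G"
  defines "g \<equiv> \<lambda>h. \<Sum>u\<in>Poly_Mapping.keys p. cnj (Poly_Mapping.lookup p u) *\<^sub>C component u h"
  shows "norm (g h) \<le> path_norm G p * norm h"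
proof -
  let ?K = "Poly_Mapping.keys p" and ?L = "path_eval (left_creation G) (vertex_projection G)"
  have K: "u \<in> free_semigroupoid G" if "u \<in> ?K" for u
    using p that by (auto simp: path_algebra_def)
  have "(norm (g h))\<^sup>2 \<le> (path_norm G p)\<^sup>2 * (norm h)\<^sup>2"
  proof (rule norm_le_by_components)
    fix W assume W: "finite W" "W \<subseteq> free_semigroupoid G"
    \<comment> \<open>the finitely many products \<open>u w\<close> of the paths \<open>u\<close> of \<open>p\<close> and the paths \<open>w\<close> in \<open>W\<close>\<close>
    define V where "V = {v \<in> free_semigroupoid G. \<exists>u\<in>?K. \<exists>w\<in>W. ?L u (ket w) = ket v}"
    have ket_inj: "i = j" if "ket i = ket j" for i j :: "('v, 'e) gpath"
      using cinner_ket_ket[of i j] that by (auto simp: cinner_ket_ket split: if_splits)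
    have "finite {v. ?L u (ket w) = ket v}" for u w
    proof (rule finite_subset)
      show "{v. ?L u (ket w) = ket v} \<subseteq> {THE v. ?L u (ket w) = ket v}"
        using ket_inj by (auto intro!: the_equality[symmetric])
    qed simp
    then have "finite (\<Union>u\<in>?K. \<Union>w\<in>W. {v. ?L u (ket w) = ket v})" using W(1) by simp
    then have V: "finite V" "V \<subseteq> free_semigroupoid G"
      by (rule rev_finite_subset) (auto simp: V_def)
    define c where "c w v = cnj (ell2_coeff (regular_eval G p (ket w)) v)" for w v
    have path: "component w (component u h) = (\<Sum>v\<in>V. cnj (ell2_coeff (?L u (ket w)) v) *\<^sub>C component v h)"
      if "u \<in> ?K" "w \<in> W" for u w
    proof -
      have "w \<in> free_semigroupoid G" using that W by blast
      from component_component[OF K[OF that(1)] this] show ?thesis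
      proof (elim disjE bexE conjE)
        fix v assume v: "v \<in> free_semigroupoid G" "?L u (ket w) = ket v"
          "\<forall>h. component w (component u h) = component v h"
        then have "v \<in> V" using that by (auto simp: V_def)
        then show ?thesis using v V(1)
          by (simp add: ket.rep_eq if_distrib[of "\<lambda>x. x *\<^sub>C _"] if_distrib[of cnj] cong: if_cong)
      qed (simp add: zero_ell2.rep_eq)
    qed
    have row: "component w (g h) = (\<Sum>v\<in>V. c w v *\<^sub>C component v h)" if w: "w \<in> W" for w
    proof -
      have "component w (g h) = (\<Sum>u\<in>?K. cnj (Poly_Mapping.lookup p u) *\<^sub>C component w (component u h))"
        unfolding g_def using w W(2) by (intro complex_linear_combination linear_component) auto
      also have "\<dots> = (\<Sum>u\<in>?K. \<Sum>v\<in>V.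
          cnj (Poly_Mapping.lookup p u * ell2_coeff (?L u (ket w)) v) *\<^sub>C component v h)"
        by (intro sum.cong refl) (simp add: path w scaleC_sum_right scaleC_scaleC)
      also have "\<dots> = (\<Sum>v\<in>V. c w v *\<^sub>C component v h)"
        by (subst sum.swap)
          (simp add: c_def poly_eval_def ell2_coeff_sum ell2_coeff_scaleC scaleC_sum_left)
      finally show ?thesis .
    qed
    \<comment> \<open>cut off outside \<open>V\<close>, so that only finitely many entries are non-zero\<close>
    define k where "k v = (if v \<in> V then component v h else 0)" for v
    have "(\<Sum>w\<in>W. defect (component w (g h)))
        = (\<Sum>w\<in>W. defect (\<Sum>v\<in>V. c w v *\<^sub>C k v))"
      by (intro sum.cong refl) (simp add: row k_def)
    also have "\<dots> \<le> (path_norm G p)\<^sup>2 * (\<Sum>v\<in>V. defect (k v))"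
    proof (rule scalar_contraction_on_vectors[OF V(1)])
      show "(\<Sum>w\<in>W. (cmod (\<Sum>v\<in>V. c w v * a v))\<^sup>2) \<le> (path_norm G p)\<^sup>2 * (\<Sum>v\<in>V. (cmod (a v))\<^sup>2)" for a
        unfolding c_def by (rule adjoint_matrix_contraction[OF W V(1)])
    qed (simp add: k_def)
    also have "(\<Sum>v\<in>V. defect (k v)) = (\<Sum>v\<in>V. defect (component v h))" by (simp add: k_def)
    also have "(path_norm G p)\<^sup>2 * \<dots> \<le> (path_norm G p)\<^sup>2 * (norm h)\<^sup>2"
      by (intro mult_left_mono defect_components_le V) simp
    finally show "(\<Sum>w\<in>W. defect (component w (g h))) \<le> (path_norm G p)\<^sup>2 * (norm h)\<^sup>2" .
  qed
  then have "(norm (g h))\<^sup>2 \<le> (path_norm G p * norm h)\<^sup>2" by (simp add: power_mult_distrib)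
  then show ?thesis by (rule power2_le_imp_le) (simp add: path_norm_nonneg)
qed

lemma norm_scaled_poly_le:
  assumes p: "p \<in> path_algebra G"
  shows "norm (\<Sum>w\<in>Poly_Mapping.keys p. r ^ path_length w *\<^sub>R (Poly_Mapping.lookup p w *\<^sub>C path_eval T P w x))
    \<le> path_norm G p * norm x"
proof -
  define f where "f w = r ^ path_length w *\<^sub>R (Poly_Mapping.lookup p w *\<^sub>C path_eval T P w x)" for w
  define y where "y = (\<Sum>w\<in>Poly_Mapping.keys p. f w)"
  define g where "g = (\<Sum>w\<in>Poly_Mapping.keys p. cnj (Poly_Mapping.lookup p w) *\<^sub>C component w y)"
  have f: "cinner (f w) y = cinner x (cnj (Poly_Mapping.lookup p w) *\<^sub>C component w y)"
    if "w \<in> Poly_Mapping.keys p" for w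
  proof -
    have "w \<in> free_semigroupoid G" using that p by (auto simp: path_algebra_def)
    from cinner_path_eval[OF this, of x y] show ?thesis
      by (simp add: f_def cinner_scaleR_left cinner_scaleC_left cinner_scaleC_right)
  qed
  have "cinner y y = (\<Sum>w\<in>Poly_Mapping.keys p. cinner (f w) y)"
    by (subst (1) y_def) (rule cinner_sum_left)
  also have "\<dots> = (\<Sum>w\<in>Poly_Mapping.keys p. cinner x (cnj (Poly_Mapping.lookup p w) *\<^sub>C component w y))"
    by (rule sum.cong[OF refl f])
  also have "\<dots> = cinner x g" unfolding g_def by (rule cinner_sum_right[symmetric])
  finally have "(norm y)\<^sup>2 = cmod (cinner x g)"
    by (metis cinner_self norm_of_real abs_power2)
  also have "\<dots> \<le> norm x * norm g" by (rule cinner_cauchy_schwarz)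
  also have "\<dots> \<le> norm x * (path_norm G p * norm y)"
    unfolding g_def by (intro mult_left_mono norm_adjoint_poly_le p) simp
  finally have "norm y * norm y \<le> (path_norm G p * norm x) * norm y"
    by (simp add: power2_eq_square mult_ac)
  moreover have "0 \<le> path_norm G p * norm x" by (simp add: path_norm_nonneg)
  ultimately have "norm y \<le> path_norm G p * norm x" by (cases "norm y = 0") auto
  then show ?thesis by (simp add: y_def f_def)
qed

end

section \<open>The von Neumann inequality for stabilized row contractions\<close>

theorem theorem5p1:
  fixes G :: "('v, 'e) pre_digraph"
    and T :: "'e \<Rightarrow> 'h::chilbert_space \<Rightarrow> 'h"
    and P :: "'v \<Rightarrow> 'h \<Rightarrow> 'h"
  assumes "wf_digraph G" and "countable (verts G)" and "countable (arcs G)"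
    and "no_sinks G"
    and "row_contraction (arcs G) T"
    and "stabilizes G P T"
  shows "\<forall>p\<in>path_algebra G. onorm (poly_eval T P p) \<le> path_norm G p"
proof
  fix p assume p: "p \<in> path_algebra G"
  show "onorm (poly_eval T P p) \<le> path_norm G p"
  proof (rule onorm_bound[OF path_norm_nonneg])
    fix x
    \<comment> \<open>\<open>p\<close> evaluated at the row scaled by \<open>r\<close>; the inequality for \<open>T\<close> is the limit \<open>r \<rightarrow> 1\<close>\<close>
    define F where "F r = norm (\<Sum>w\<in>Poly_Mapping.keys p.
      r ^ path_length w *\<^sub>R (Poly_Mapping.lookup p w *\<^sub>C path_eval T P w x))" for r :: real
    have "F r \<le> path_norm G p * norm x" if "0 \<le> r" "r < 1" for r
    proof -
      interpret scaled_stabilized_row G T P r by (rule scaled_stabilized_row.intro) (use assms that in auto)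
      show ?thesis unfolding F_def by (rule norm_scaled_poly_le[OF p])
    qed
    then have bound: "\<forall>\<^sub>F r in at_left 1. F r \<le> path_norm G p * norm x"
      by (intro eventually_at_leftI[of 0]) auto
    have "(F \<longlongrightarrow> F 1) (at_left 1)" unfolding F_def by (intro tendsto_intros)
    then have "F 1 \<le> path_norm G p * norm x"
      by (rule tendsto_upperbound[OF _ bound trivial_limit_at_left_real])
    then show "norm (poly_eval T P p x) \<le> path_norm G p * norm x"
      by (simp add: F_def poly_eval_def)
  qed
qed

end
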